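(* Let $q+1<p\le 2$, and let $a\ge q(1-q)$ in the case $p=2$. Assume that there exists $K_1>0$ such that $t\,\dot\delta(t)<K_1\,\delta(t)$ for all $t$ big enough. Let $x:[t_0,+\infty)\to\mathcal X$ be the unique global solution of the system (DS) given in the context. Then, for any $x^*\in\operatorname{argmin} g$: the trajectory $x(t)$ is bounded; $$g(x(t))-g(x^* )=\mathcal O\left(\frac{1}{\delta(t)t^{2q}}\right),\qquad \|\dot x(t)+\beta\nabla g(x(t))\|=\mathcal O\left(\frac{1}{t^q}\right),\quad\text{as } t\to+\infty;$$ and $$\int_{t_0}^{+\infty}\delta(t)t^q\,(g(x(t))-g(x^* ))\,dt<+\infty,\qquad \int_{t_0}^{+\infty}t^{q-p}\|x(t)\|^2dt<+\infty,$$ $$\int_{t_0}^{+\infty}t^q\|\dot x(t)\|^2dt<+\infty,\qquad \int_{t_0}^{+\infty}\delta(t)t^{2q}\|\nabla g(x(t))\|^2dt<+\infty,$$ $$\int_{t_0}^{+\infty}t^{q-p}\|x(t)-x^*\|^2dt<+\infty.$$ Moreover, for $0<b<\alpha$, the limit $\lim_{t\to+\infty}\mathcal E_b(t)$ exists in $\mathbb R$, where $\mathcal E_b$ is the energy function defined in the context.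
   Context: $\mathcal X$ is a real Hilbert space with inner product $\langle\cdot,\cdot\rangle$ and norm $\|\cdot\|$. $g:\mathcal X\to\mathbb R$ is a convex, twice differentiable function, and $\operatorname{argmin} g$ is its set of minimizers. The parameters satisfy $t_0>0$, $\alpha,\beta,a,p>0$, $0<q<1$. The time scaling function $\delta:[t_0,+\infty)\to(0,+\infty)$ is differentiable and non-decreasing with $\lim_{t\to+\infty}\delta(t)=+\infty$. The system (DS) is $$\ddot x(t)+\frac{\alpha}{t^q}\dot x(t)+\beta\nabla^2 g(x(t))\dot x(t)+\delta(t)\nabla g(x(t))+\frac{a}{t^p}x(t)=0,\qquad t\ge t_0.$$ A (strong) global solution is a function $x:[t_0,+\infty)\to\mathcal X$ with $x$ and $\dot x$ locally absolutely continuous, satisfying the equation for almost every $t\ge t_0$, with prescribed initial data $(x(t_0),\dot x(t_0))\in\mathcal X\times\mathcal X$. For $0<b<\alpha$ and $x^*\in\operatorname{argmin} g$, the energy function is $$\mathcal E_b(t)=\left(\delta(t)t^{2q}-\beta(b+2qt^{q-1}-\alpha)t^q\right)(g(x(t))-g(x^* ))+\frac12 a t^{2q-p}\|x(t)\|^2$$ $$+\frac12\left\|b(x(t)-x^* )+t^q(\dot x(t)+\beta\nabla g(x(t)))\right\|^2+\frac12 b(\alpha-b-qt^{q-1})\|x(t)-x^*\|^2.$$ *)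

theory Defs
  imports "HOL-Analysis.Analysis" "HOL-Library.Landau_Symbols"
begin

text \<open>A real Hilbert space is a type of class \<open>{real_inner, banach}\<close>. The gradient is the Riesz
  representative of the Frechet derivative, and the Hessian is the Frechet derivative of the
  gradient, as an operator on the space. Both are meaningful only for functions that satisfy
  \<open>twice_differentiable\<close>; by the Riesz theorem the gradient of a Frechet differentiable function
  exists everywhere.\<close>

definition gradient :: "('a::{real_inner, banach} \<Rightarrow> real) \<Rightarrow> 'a \<Rightarrow> 'a" where
  "gradient g x = (THE D. GDERIV g x :> D)"

definition hessian :: "('a::{real_inner, banach} \<Rightarrow> real) \<Rightarrow> 'a \<Rightarrow> 'a \<Rightarrow> 'a" where
  "hessian g x = frechet_derivative (gradient g) (at x)"

definition twice_differentiable :: "('a::{real_inner, banach} \<Rightarrow> real) \<Rightarrow> bool" where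
  "twice_differentiable g \<longleftrightarrow>
     (\<forall>x. g differentiable (at x)) \<and> (\<forall>x. gradient g differentiable (at x))"

definition argmin :: "('a \<Rightarrow> real) \<Rightarrow> 'a set" where
  "argmin g = {x. is_arg_min g (\<lambda>_. True) x}"

definition abs_continuous_on :: "real \<Rightarrow> real \<Rightarrow> (real \<Rightarrow> 'a::real_normed_vector) \<Rightarrow> bool" where
  "abs_continuous_on c d f \<longleftrightarrow>
     (\<forall>\<epsilon>>0. \<exists>\<eta>>0. \<forall>(n::nat) (l::nat \<Rightarrow> real) (u::nat \<Rightarrow> real).
        (\<forall>i<n. c \<le> l i \<and> l i \<le> u i \<and> u i \<le> d) \<longrightarrow>
        disjoint_family_on (\<lambda>i. {l i<..<u i}) {..<n} \<longrightarrow>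
        (\<Sum>i<n. u i - l i) < \<eta> \<longrightarrow>
        (\<Sum>i<n. norm (f (u i) - f (l i))) < \<epsilon>)"

definition locally_abs_continuous :: "real \<Rightarrow> (real \<Rightarrow> 'a::real_normed_vector) \<Rightarrow> bool" where
  "locally_abs_continuous t0 f \<longleftrightarrow> (\<forall>T\<ge>t0. abs_continuous_on t0 T f)"

text \<open>A trajectory on \<open>[t0, \<infinity>)\<close> is a total function whose values to the left of \<open>t0\<close> are ignored;
  its time derivative at \<open>t0\<close> is therefore the right derivative.\<close>

definition tderiv :: "real \<Rightarrow> (real \<Rightarrow> 'a::real_normed_vector) \<Rightarrow> real \<Rightarrow> 'a" where
  "tderiv t0 x t = vector_derivative x (at t within {t0..})"

text \<open>Local absolute continuity of the velocity presupposes that the velocity exists at every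
  time, so the trajectory is required to be differentiable everywhere. The acceleration is only
  required to exist almost everywhere, as part of the equation.\<close>

definition global_solution ::
  "('a::{real_inner, banach} \<Rightarrow> real) \<Rightarrow> (real \<Rightarrow> real) \<Rightarrow> real \<Rightarrow> real \<Rightarrow> real \<Rightarrow> real \<Rightarrow> real \<Rightarrow>
     real \<Rightarrow> 'a \<Rightarrow> 'a \<Rightarrow> (real \<Rightarrow> 'a) \<Rightarrow> bool" where
  "global_solution g \<delta> \<alpha> \<beta> a p q t0 x0 v0 x \<longleftrightarrow>
     locally_abs_continuous t0 x \<and>
     (\<forall>t\<ge>t0. x differentiable (at t within {t0..})) \<and>
     locally_abs_continuous t0 (tderiv t0 x) \<and>
     (AE t in lebesgue. t \<ge> t0 \<longrightarrow>
        tderiv t0 x differentiable (at t within {t0..}) \<and>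
        tderiv t0 (tderiv t0 x) t
          + (\<alpha> / t powr q) *\<^sub>R tderiv t0 x t
          + \<beta> *\<^sub>R hessian g (x t) (tderiv t0 x t)
          + \<delta> t *\<^sub>R gradient g (x t)
          + (a / t powr p) *\<^sub>R x t = 0) \<and>
     x t0 = x0 \<and> tderiv t0 x t0 = v0"

definition energy ::
  "('a::{real_inner, banach} \<Rightarrow> real) \<Rightarrow> (real \<Rightarrow> real) \<Rightarrow> real \<Rightarrow> real \<Rightarrow> real \<Rightarrow> real \<Rightarrow> real \<Rightarrow>
     real \<Rightarrow> (real \<Rightarrow> 'a) \<Rightarrow> 'a \<Rightarrow> real \<Rightarrow> real \<Rightarrow> real" where
  "energy g \<delta> \<alpha> \<beta> a p q t0 x xstar b t =
     (\<delta> t * t powr (2 * q) - \<beta> * (b + 2 * q * t powr (q - 1) - \<alpha>) * t powr q)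
       * (g (x t) - g xstar)
     + 1 / 2 * a * t powr (2 * q - p) * (norm (x t))\<^sup>2
     + 1 / 2 * (norm (b *\<^sub>R (x t - xstar)
                 + t powr q *\<^sub>R (tderiv t0 x t + \<beta> *\<^sub>R gradient g (x t))))\<^sup>2
     + 1 / 2 * b * (\<alpha> - b - q * t powr (q - 1)) * (norm (x t - xstar))\<^sup>2"

end

theory Submission
  imports Defs
begin

text \<open>The sum \<open>w = x' + \<beta> \<nabla>g(x)\<close> of an absolutely continuous and an everywhere differentiable
  function is the Henstock-Kurzweil primitive of its almost everywhere derivative. By the equation,
  this derivative is the continuous function
  \<open>- (\<alpha>/t\<^sup>q x' + \<delta> \<nabla>g(x) + a/t\<^sup>p x)\<close>. Hence \<open>w\<close> is continuously differentiable and, although the Hessian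
  need not be continuous, the energy is differentiable at every \<open>t > t0\<close>.

  The coefficients of the energy are chosen so that all cross terms with \<open>x'\<close> cancel in its
  derivative. For large \<open>t\<close> the remainder is at most
  \<open>- c (\<delta> t\<^sup>q (g(x) - g(x*)) + t\<^sup>q \<parallel>x'\<parallel>\<^sup>2 + \<delta> t\<^bsup>2q\<^esup> \<parallel>\<nabla>g(x)\<parallel>\<^sup>2) + C t\<^bsup>q-p\<^esup>\<close>, and \<open>t\<^bsup>q-p\<^esup>\<close> is integrable because
  \<open>p > q + 1\<close>. Adding \<open>C t\<^bsup>q-p+1\<^esup> / (p-q-1)\<close> to the energy thus gives a decreasing nonnegative function,
  which yields the bounds, the integrals and the limit.\<close>

section \<open>Absolute continuity and the Henstock-Kurzweil integral\<close>

lemma abs_continuous_on_imp_continuous_on: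
  assumes "abs_continuous_on c d F"
  shows "continuous_on {c..d} F"
proof (clarsimp simp: continuous_on_iff)
  fix s and e :: real
  assume s: "c \<le> s" "s \<le> d" and e: "0 < e"
  obtain \<eta> where \<eta>: "\<eta> > 0"
    and F: "\<And>(n::nat) l u. (\<forall>i<n. c \<le> l i \<and> l i \<le> u i \<and> u i \<le> d)
        \<Longrightarrow> disjoint_family_on (\<lambda>i. {l i<..<u i}) {..<n}
        \<Longrightarrow> (\<Sum>i<n. u i - l i) < \<eta> \<Longrightarrow> (\<Sum>i<n. norm (F (u i) - F (l i))) < e"
    using assms e unfolding abs_continuous_on_def by meson
  have "dist (F t) (F s) < e" if t: "t \<in> {c..d}" "dist t s < \<eta>" for t
  proof -
    \<comment> \<open>A family of one interval is enough; \<open>min\<close> and \<open>max\<close>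
      order its endpoints on either side of \<open>s\<close>.\<close>
    have "(\<Sum>i<(1::nat). norm (F (max s t) - F (min s t))) < e"
      by (rule F) (use s t in \<open>auto simp: disjoint_family_on_def dist_real_def\<close>)
    then show ?thesis
      by (cases "s \<le> t") (auto simp: dist_norm max_def min_def norm_minus_commute)
  qed
  then show "\<exists>\<eta>>0. \<forall>t\<in>{c..d}. dist t s < \<eta> \<longrightarrow> dist (F t) (F s) < e"
    using \<eta> by blast
qed

text \<open>Intervals tagged in \<open>N\<close> lie in an open set of small measure, so absolute continuity controls
  their contribution; the remaining ones are controlled by the derivative.\<close>

lemma has_integral_abs_continuous:
  fixes F :: "real \<Rightarrow> 'a::real_normed_vector"
  assumes ac: "abs_continuous_on c d F" and "c \<le> d" and N: "negligible N"
    and der: "\<And>t. t \<in> {c..d} - N \<Longrightarrow> (F has_vector_derivative f t) (at t within {c..d})"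
  shows "(f has_integral (F d - F c)) {c..d}"
proof (rule has_integral_spike[OF N])
  \<comment> \<open>The value 0 on \<open>N\<close> leaves an interval tagged there with nothing but
    the increment of \<open>F\<close>, however large \<open>f\<close> is on
    \<open>N\<close>.\<close>
  define f0 where "f0 t = (if t \<in> N then 0 else f t)" for t
  show "f t = f0 t" if "t \<in> {c..d} - N" for t
    using that by (simp add: f0_def)
  show "(f0 has_integral (F d - F c)) {c..d}"
    unfolding has_integral_real
  proof (intro allI impI)
    fix e :: real
    assume e: "e > 0"
    \<comment> \<open>The added 1 keeps the denominator positive when \<open>c = d\<close>.\<close>
    define e' where "e' = e / (2 * (d - c + 1))"
    have e': "e' > 0" "e' * (d - c) \<le> e / 2"
      using e \<open>c \<le> d\<close> by (auto simp: e'_def field_simps)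
    have "e / 2 > 0" using e by simp
    then obtain \<eta> where \<eta>: "\<eta> > 0"
      and F: "\<And>(n::nat) l u. (\<forall>i<n. c \<le> l i \<and> l i \<le> u i \<and> u i \<le> d)
          \<Longrightarrow> disjoint_family_on (\<lambda>i. {l i<..<u i}) {..<n}
          \<Longrightarrow> (\<Sum>i<n. u i - l i) < \<eta> \<Longrightarrow> (\<Sum>i<n. norm (F (u i) - F (l i))) < e / 2"
      using ac unfolding abs_continuous_on_def by meson
    have N0: "N \<in> null_sets lebesgue"
      using N negligible_iff_null_sets by blast
    then obtain U where U: "open U" "N \<subseteq> U" "emeasure lebesgue (U - N) < ennreal \<eta>"
      using sets_lebesgue_outer_open[of N \<eta>] \<eta> by blast
    have mU: "emeasure lebesgue U < ennreal \<eta>"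
      using U emeasure_Diff_null_set[OF N0, of U] by auto
    have "\<exists>r>0. \<forall>y\<in>{c..d}. norm (y - t) < r \<longrightarrow>
        norm (F y - F t - (y - t) *\<^sub>R f t) \<le> e' * norm (y - t)" if "t \<in> {c..d} - N" for t
      using der[OF that] e'(1) unfolding has_vector_derivative_def has_derivative_within_alt by blast
    then obtain r where r: "\<And>t. t \<in> {c..d} - N \<Longrightarrow> r t > 0"
      "\<And>t y. \<lbrakk>t \<in> {c..d} - N; y \<in> {c..d}; norm (y - t) < r t\<rbrakk> \<Longrightarrow>
        norm (F y - F t - (y - t) *\<^sub>R f t) \<le> e' * norm (y - t)"
      by metis
    \<comment> \<open>A tag in \<open>N\<close> confines its interval to \<open>U\<close>, whose
      measure is below \<open>\<eta>\<close>; any other tag in \<open>{c..d}\<close> confines it to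
      a ball where the linear approximation has relative error \<open>e'\<close>.\<close>
    define \<gamma> where "\<gamma> t = (if t \<in> N then U else if t \<in> {c..d} then ball t (r t) else UNIV)" for t
    have "gauge \<gamma>"
      unfolding gauge_def \<gamma>_def using U r(1) by auto
    moreover have "norm ((\<Sum>(t, K)\<in>p. measure lborel K *\<^sub>R f0 t) - (F d - F c)) < e"
      if p: "p tagged_division_of {c..d}" and fine: "\<gamma> fine p" for p
    proof -
      have K: "\<exists>l u. K = {l..u} \<and> c \<le> l \<and> l \<le> t \<and> t \<le> u \<and> u \<le> d \<and> t \<in> {c..d}" if tK: "(t, K) \<in> p" for t K
      proof -
        obtain l u where lu: "K = {l..u}" "t \<in> K" "K \<subseteq> {c..d}"
          using tagged_division_ofD(2-4)[OF p tK] by auto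
        then have "l \<in> K" "u \<in> K" by auto
        with lu have "c \<le> l" "u \<le> d" by (meson atLeastAtMost_iff subsetD)+
        with lu show ?thesis by auto
      qed
      \<comment> \<open>\<open>D\<close> is the error of one interval. The increments of
        \<open>F\<close> telescope over the division, so these errors add up to the total
        error.\<close>
      define D where "D = (\<lambda>(t::real, K). measure lborel K *\<^sub>R f0 t - (F (Sup K) - F (Inf K)))"
      define p1 where "p1 = {tK \<in> p. fst tK \<in> N}"
      have fin: "finite p" "finite p1"
        using p by (auto simp: p1_def)
      have "(\<Sum>(t, K)\<in>p. measure lborel K *\<^sub>R f0 t) - (F d - F c) = sum D p"
        using additive_tagged_division_1[OF \<open>c \<le> d\<close> p, of F]
        by (simp add: D_def split_def sum_subtractf)
      also have "\<dots> = sum D (p - p1) + sum D p1"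
        by (rule sum.subset_diff) (auto simp: p1_def fin)
      finally have split: "norm ((\<Sum>(t, K)\<in>p. measure lborel K *\<^sub>R f0 t) - (F d - F c))
          \<le> norm (sum D (p - p1)) + norm (sum D p1)"
        by (simp add: norm_triangle_ineq)
      have "norm (sum D (p - p1)) \<le> (\<Sum>(t, K)\<in>p - p1. e' * (Sup K - Inf K))"
      proof (rule sum_norm_le, clarify)
        fix t and K :: "real set"
        assume tK: "(t, K) \<in> p" "(t, K) \<notin> p1"
        then obtain l u where lu: "K = {l..u}" "c \<le> l" "l \<le> t" "t \<le> u" "u \<le> d" "t \<in> {c..d}"
          using K by blast
        have t: "t \<in> {c..d} - N" using tK lu by (auto simp: p1_def)
        have sub: "K \<subseteq> ball t (r t)"
          using fineD[OF fine tK(1)] t by (simp add: \<gamma>_def)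
        have "l \<in> K" "u \<in> K"
          using lu by auto
        then have "l \<in> ball t (r t)" "u \<in> ball t (r t)"
          using sub by blast+
        then have "norm (l - t) < r t" "norm (u - t) < r t"
          by (auto simp: dist_real_def)
        then have "norm (F l - F t - (l - t) *\<^sub>R f t) \<le> e' * norm (l - t)"
          "norm (F u - F t - (u - t) *\<^sub>R f t) \<le> e' * norm (u - t)"
          using r(2)[OF t, of l] r(2)[OF t, of u] lu by auto
        \<comment> \<open>The values at the tag cancel, and as \<open>t\<close> lies between
          \<open>l\<close> and \<open>u\<close> the two endpoint errors add up to \<open>e'\<close>
          times the length.\<close>
        then have "norm ((F l - F t - (l - t) *\<^sub>R f t) - (F u - F t - (u - t) *\<^sub>R f t))
            \<le> e' * norm (l - t) + e' * norm (u - t)"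
          by (meson add_mono norm_triangle_ineq4 order_trans)
        also have "\<dots> = e' * (u - l)"
          using lu by (simp add: algebra_simps)
        finally show "norm (D (t, K)) \<le> e' * (Sup K - Inf K)"
          using lu t by (simp add: D_def f0_def algebra_simps)
      qed
      also have "\<dots> \<le> (\<Sum>(t, K)\<in>p. e' * (Sup K - Inf K))"
        by (rule sum_mono2) (use fin K e' in \<open>fastforce+\<close>)
      also have "\<dots> = e' * (d - c)"
        using additive_tagged_division_1[OF \<open>c \<le> d\<close> p, of "\<lambda>t. t"]
        by (simp add: split_def flip: sum_distrib_left)
      finally have good: "norm (sum D (p - p1)) \<le> e / 2"
        using e' by linarith
      \<comment> \<open>Absolute continuity speaks of indexed families, so the intervals tagged in
        \<open>N\<close> are enumerated.\<close>
      obtain h where h: "bij_betw h {..<card p1} p1"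
        using ex_bij_betw_nat_finite[OF fin(2)] by (auto simp: lessThan_atLeast0)
      define l u where "l i = Inf (snd (h i))" and "u i = Sup (snd (h i))" for i
      have hi: "h i \<in> p \<and> fst (h i) \<in> N \<and> snd (h i) = {l i..u i} \<and> c \<le> l i \<and> l i \<le> u i \<and> u i \<le> d
          \<and> {l i..u i} \<subseteq> U" if "i < card p1" for i
      proof -
        have hp1: "h i \<in> p1" using h that by (auto simp: bij_betw_def)
        obtain t K where tK: "h i = (t, K)" by fastforce
        with hp1 have tKp: "(t, K) \<in> p" "t \<in> N" by (auto simp: p1_def)
        obtain l' u' where lu: "K = {l'..u'}" "c \<le> l'" "l' \<le> t" "t \<le> u'" "u' \<le> d"
          using K[OF tKp(1)] by blast
        have "K \<subseteq> U"
          using fineD[OF fine tKp(1)] tKp(2) by (simp add: \<gamma>_def)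
        then show ?thesis
          using tK lu hp1 by (auto simp: l_def u_def p1_def)
      qed
      have disj: "disjoint_family_on (\<lambda>i. {l i<..<u i}) {..<card p1}"
        unfolding disjoint_family_on_def
      proof (intro ballI impI)
        fix i j assume ij: "i \<in> {..<card p1}" "j \<in> {..<card p1}" "i \<noteq> j"
        then have "h i \<noteq> h j" using h by (auto simp: bij_betw_def inj_on_def)
        then have "interior (snd (h i)) \<inter> interior (snd (h j)) = {}"
          using tagged_division_ofD(5)[OF p, of "fst (h i)" "snd (h i)" "fst (h j)" "snd (h j)"]
            hi ij by (auto simp: prod_eq_iff)
        then show "{l i<..<u i} \<inter> {l j<..<u j} = {}"
          using hi ij by simp
      qed
      \<comment> \<open>Disjoint open intervals inside \<open>U\<close> have total length at most
        the measure of \<open>U\<close>, hence below the threshold \<open>\<eta>\<close> of absolute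
        continuity.\<close>
      have "ennreal (\<Sum>i<card p1. u i - l i) = (\<Sum>i<card p1. emeasure lebesgue {l i<..<u i})"
        using hi by (subst sum_ennreal[symmetric]) (auto intro!: sum.cong)
      also have "\<dots> = emeasure lebesgue (\<Union>i<card p1. {l i<..<u i})"
        by (rule sum_emeasure) (use disj in auto)
      also have "\<dots> \<le> emeasure lebesgue U"
      proof (rule emeasure_mono)
        show "(\<Union>i<card p1. {l i<..<u i}) \<subseteq> U"
          using hi greaterThanLessThan_subseteq_atLeastAtMost_iff by fastforce
      qed (use U in auto)
      finally have "ennreal (\<Sum>i<card p1. u i - l i) < ennreal \<eta>"
        using mU by order
      then have "(\<Sum>i<card p1. u i - l i) < \<eta>"
        using hi by (subst (asm) ennreal_less_iff) (auto intro!: sum_nonneg)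
      then have "(\<Sum>i<card p1. norm (F (u i) - F (l i))) < e / 2"
        using F[of "card p1" l u] disj hi by blast
      moreover have "sum D p1 = (\<Sum>i<card p1. - (F (u i) - F (l i)))"
        by (subst sum.reindex_bij_betw[OF h, symmetric])
          (use hi in \<open>auto simp: D_def split_def f0_def l_def u_def intro!: sum.cong\<close>)
      ultimately have "norm (sum D p1) < e / 2"
        by (smt (verit) norm_sum sum_norm_le norm_minus_cancel)
      with split good show ?thesis by linarith
    qed
    ultimately show "\<exists>\<gamma>. gauge \<gamma> \<and> (\<forall>p. p tagged_division_of {c..d} \<and> \<gamma> fine p \<longrightarrow>
        norm ((\<Sum>(t, K)\<in>p. measure lborel K *\<^sub>R f0 t) - (F d - F c)) < e)"
      by (intro exI[of _ \<gamma>]) simp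
  qed
qed

section \<open>Riesz representation, gradients and convexity\<close>

theorem riesz_representation:
  fixes f :: "'a::{real_inner, banach} \<Rightarrow> real"
  assumes "bounded_linear f"
  obtains D where "\<And>h. f h = inner h D"
proof -
  interpret f: bounded_linear f by fact
  \<comment> \<open>The representative is the minimizer of the strictly convex functional \<open>J\<close>.\<close>
  define J where "J y = (norm y)\<^sup>2 - 2 * f y" for y
  obtain K where K: "\<And>y. norm (f y) \<le> norm y * K"
    using f.bounded by blast
  \<comment> \<open>Completing the square: \<open>J y\<close> is at least
    \<open>(norm y - K)^2 - K^2\<close>.\<close>
  have "- K\<^sup>2 \<le> J y" for y
    using K[of y] zero_le_power2[of "norm y - K"]
    by (simp add: J_def power2_eq_square algebra_simps)
  then have bdd: "bdd_below (range J)"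
    by (auto simp: bdd_below_def)
  define m where "m = Inf (range J)"
  have m: "m \<le> J y" for y
    unfolding m_def using bdd by (simp add: cInf_lower)
  have "\<exists>y. J y < m + inverse (real (Suc n))" for n
    using cInf_lessD[of "range J" "m + inverse (real (Suc n))"] by (auto simp: m_def)
  then obtain y where y: "\<And>n. J (y n) < m + inverse (real (Suc n))"
    by metis
  \<comment> \<open>The linear part of \<open>J\<close> cancels against the midpoint, so the
    parallelogram law turns near-minimality of \<open>u\<close> and \<open>v\<close> into closeness:
    a minimizing sequence is Cauchy.\<close>
  have parallelogram: "(norm (u - v))\<^sup>2 = 2 * (J u + J v - 2 * J ((1/2) *\<^sub>R (u + v)))" for u v
    unfolding J_def power2_norm_eq_inner
    by (simp add: f.scaleR f.add inner_simps inner_commute algebra_simps)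
  have close: "(norm (y n - y k))\<^sup>2 < 2 * (inverse (real (Suc n)) + inverse (real (Suc k)))" for n k
    unfolding parallelogram using y[of n] y[of k] m[of "(1/2) *\<^sub>R (y n + y k)"] by argo
  have "Cauchy y"
  proof (rule metric_CauchyI)
    fix e :: real assume e: "e > 0"
    then obtain M where M: "inverse (real (Suc M)) < e\<^sup>2 / 4"
      using reals_Archimedean[of "e\<^sup>2 / 4"] by auto
    have "dist (y n) (y k) < e" if "n \<ge> M" "k \<ge> M" for n k
    proof -
      have "inverse (real (Suc n)) \<le> inverse (real (Suc M))" "inverse (real (Suc k)) \<le> inverse (real (Suc M))"
        using that by (auto intro!: le_imp_inverse_le)
      with close[of n k] M have "(norm (y n - y k))\<^sup>2 < e\<^sup>2" by argo
      then show ?thesis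
        using e by (simp add: dist_norm power_less_imp_less_base)
    qed
    then show "\<exists>M. \<forall>n\<ge>M. \<forall>k\<ge>M. dist (y n) (y k) < e" by blast
  qed
  then obtain D where D: "y \<longlonglongrightarrow> D"
    using Cauchy_convergent_iff convergent_def by blast
  have "(\<lambda>n. J (y n)) \<longlonglongrightarrow> J D"
    unfolding J_def by (intro tendsto_intros f.tendsto D)
  moreover have "(\<lambda>n. m + inverse (real (Suc n))) \<longlonglongrightarrow> m"
    using tendsto_add[OF tendsto_const LIMSEQ_inverse_real_of_nat] by simp
  ultimately have JD: "J D \<le> m"
    by (rule LIMSEQ_le) (use y less_imp_le in blast)
  have "f h = inner h D" for h
  proof (cases "h = 0")
    case False
    define r where "r = inner h D - f h"
    \<comment> \<open>This \<open>s\<close> minimizes the quadratic by which \<open>J\<close>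
      changes along \<open>h\<close>; the minimum is negative unless \<open>r = 0\<close>.\<close>
    define s where "s = - r / (norm h)\<^sup>2"
    have "0 \<le> J (D + s *\<^sub>R h) - J D"
      using JD m[of "D + s *\<^sub>R h"] by simp
    also have "\<dots> = 2 * s * r + s\<^sup>2 * (norm h)\<^sup>2"
      unfolding J_def power2_norm_eq_inner
      by (simp add: r_def f.scaleR f.add inner_simps inner_commute power2_eq_square algebra_simps)
    also have "\<dots> = - (r\<^sup>2 / (norm h)\<^sup>2)"
      using False by (simp add: s_def power2_eq_square)
    finally show ?thesis
      using False by (simp add: r_def divide_le_0_iff)
  qed (simp add: f.zero)
  then show thesis using that by blast
qed

text \<open>The definite description in \<open>gradient\<close> denotes: existence is Riesz
  representation of the derivative, uniqueness is that of the Frechet derivative.\<close>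

lemma GDERIV_gradient:
  fixes g :: "'a::{real_inner, banach} \<Rightarrow> real"
  assumes "g differentiable (at x)"
  shows "GDERIV g x :> gradient g x"
proof -
  obtain g' where g': "(g has_derivative g') (at x)"
    using assms by (auto simp: differentiable_def)
  obtain D where "\<And>h. g' h = inner h D"
    using riesz_representation has_derivative_bounded_linear[OF g'] by blast
  then have "g' = (\<lambda>h. inner h D)" by (rule ext)
  then have D: "GDERIV g x :> D"
    using g' by (simp add: gderiv_def)
  moreover have "D' = D" if "GDERIV g x :> D'" for D'
    using has_derivative_unique[OF that[unfolded gderiv_def] D[unfolded gderiv_def]]
    by (intro vector_eq_rdot[THEN iffD1]) (metis inner_commute)
  ultimately show ?thesis
    unfolding gradient_def by (rule theI)
qed

text \<open>For \<open>0 < s < 1\<close>, convexity bounds the difference quotient along the segment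
  from \<open>x\<close> to \<open>y\<close> by \<open>g y - g x\<close>; the bound survives the
  limit from the right at 0.\<close>

lemma convex_gradient_inequality:
  fixes g :: "'a::{real_inner, banach} \<Rightarrow> real"
  assumes cvx: "convex_on UNIV g" and "g differentiable (at x)"
  shows "inner (gradient g x) (y - x) \<le> g y - g x"
proof -
  have "((\<lambda>s. x + s *\<^sub>R (y - x)) has_derivative (\<lambda>s. s *\<^sub>R (y - x))) (at 0)"
    by (auto intro!: derivative_eq_intros)
  then have "((\<lambda>s. g (x + s *\<^sub>R (y - x))) has_derivative (\<lambda>s. inner (s *\<^sub>R (y - x)) (gradient g x))) (at 0)"
    by (rule has_derivative_compose) (use GDERIV_gradient[OF assms(2)] in \<open>simp add: gderiv_def\<close>)
  then have "((\<lambda>s. g (x + s *\<^sub>R (y - x))) has_real_derivative inner (gradient g x) (y - x)) (at 0)"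
    by (simp add: has_field_derivative_def inner_commute mult_commute_abs)
  then have "((\<lambda>s. (g (x + s *\<^sub>R (y - x)) - g x) / s) \<longlongrightarrow> inner (gradient g x) (y - x)) (at 0)"
    by (simp add: has_field_derivative_iff)
  then have "((\<lambda>s. (g (x + s *\<^sub>R (y - x)) - g x) / s) \<longlongrightarrow> inner (gradient g x) (y - x)) (at_right 0)"
    by (rule filterlim_mono) (auto simp: at_le)
  moreover have "\<forall>\<^sub>F s in at_right 0. (g (x + s *\<^sub>R (y - x)) - g x) / s \<le> g y - g x"
  proof (rule eventually_at_rightI[of 0 1])
    fix s :: real assume s: "s \<in> {0<..<1}"
    have "g ((1 - s) *\<^sub>R x + s *\<^sub>R y) \<le> (1 - s) * g x + s * g y"
      using convex_onD[OF cvx, of s x y] s by simp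
    moreover have "(1 - s) *\<^sub>R x + s *\<^sub>R y = x + s *\<^sub>R (y - x)"
      by (simp add: algebra_simps)
    ultimately show "(g (x + s *\<^sub>R (y - x)) - g x) / s \<le> g y - g x"
      using s by (simp add: pos_divide_le_eq) (simp add: algebra_simps)
  qed simp
  ultimately show ?thesis
    by (rule tendsto_upperbound) simp
qed

section \<open>Regularity of solutions\<close>

text \<open>Integrating the equation absorbs the Hessian term into the gradient along the trajectory
  and forgets the exceptional null set, so the result holds at every time, one-sidedly at
  \<open>t0\<close>.\<close>

lemma global_solution_first_order:
  fixes g :: "'a::{real_inner, banach} \<Rightarrow> real"
  assumes g: "twice_differentiable g" and "t0 > 0" and \<delta>: "continuous_on {t0..} \<delta>"
    and sol: "global_solution g \<delta> \<alpha> \<beta> a p q t0 x0 v0 x" and t: "t \<ge> t0"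
  shows "(x has_vector_derivative tderiv t0 x t) (at t within {t0..})"
    and "continuous_on {t0..} (tderiv t0 x)"
    and "((\<lambda>t. tderiv t0 x t + \<beta> *\<^sub>R gradient g (x t)) has_vector_derivative
           - ((\<alpha> / t powr q) *\<^sub>R tderiv t0 x t + \<delta> t *\<^sub>R gradient g (x t) + (a / t powr p) *\<^sub>R x t))
         (at t within {t0..})"
proof -
  define V where "V = tderiv t0 x"
  define H where "H t = gradient g (x t)" for t
  define k where "k t = - ((\<alpha> / t powr q) *\<^sub>R V t + \<delta> t *\<^sub>R H t + (a / t powr p) *\<^sub>R x t)" for t
  have x: "(x has_vector_derivative V t) (at t within {t0..})" if "t \<ge> t0" for t
    using sol that unfolding global_solution_def V_def tderiv_def
    by (simp add: vector_derivative_works)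
  then show "(x has_vector_derivative tderiv t0 x t) (at t within {t0..})"
    using t V_def by simp
  have H: "(H has_vector_derivative hessian g (x t) (V t)) (at t within {t0..})" if "t \<ge> t0" for t
  proof -
    have "(gradient g has_derivative hessian g (x t)) (at (x t))"
      using g unfolding twice_differentiable_def hessian_def
      by (simp add: frechet_derivative_works)
    then show ?thesis
      using vector_derivative_diff_chain_within[OF x[OF that], of "gradient g"]
      by (simp add: H_def[abs_def] comp_def has_derivative_at_withinI)
  qed
  have V_ac: "abs_continuous_on t0 T V" if "T \<ge> t0" for T
    using sol that by (simp add: global_solution_def locally_abs_continuous_def V_def)
  have cont_V: "continuous_on {t0..} V"
    unfolding continuous_on_eq_continuous_within
  proof
    fix t assume t: "t \<in> {t0..}"
    then have "continuous (at t within {t0..t + 1}) V"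
      using abs_continuous_on_imp_continuous_on[OF V_ac[of "t + 1"]]
      by (auto simp: continuous_on_eq_continuous_within)
    \<comment> \<open>Continuity at \<open>t\<close> only sees times below \<open>t + 1\<close>, so
      a compact interval can replace the half-line.\<close>
    moreover have "at t within {t0..t + 1} = at t within {t0..}"
      by (rule at_within_nhd[of _ "{..<t + 1}"]) (use t in auto)
    ultimately show "continuous (at t within {t0..}) V" by simp
  qed
  then show "continuous_on {t0..} (tderiv t0 x)" by (simp add: V_def)
  have cont: "continuous_on {t0..} x" "continuous_on {t0..} H"
    by (rule continuous_on_vector_derivative, use x H in auto)+
  have cont_k: "continuous_on {t0..} k"
    unfolding k_def by (intro continuous_intros cont cont_V \<delta>) (use \<open>t0 > 0\<close> in auto)
  obtain N where N: "N \<in> null_sets lebesgue"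
    and ode: "\<And>t. t \<notin> N \<Longrightarrow> t \<ge> t0 \<Longrightarrow> V differentiable (at t within {t0..}) \<and>
          tderiv t0 V t + (\<alpha> / t powr q) *\<^sub>R V t + \<beta> *\<^sub>R hessian g (x t) (V t)
          + \<delta> t *\<^sub>R H t + (a / t powr p) *\<^sub>R x t = 0"
  proof -
    have "AE t in lebesgue. t \<ge> t0 \<longrightarrow> V differentiable (at t within {t0..}) \<and>
          tderiv t0 V t + (\<alpha> / t powr q) *\<^sub>R V t + \<beta> *\<^sub>R hessian g (x t) (V t)
          + \<delta> t *\<^sub>R H t + (a / t powr p) *\<^sub>R x t = 0"
      using sol by (simp add: global_solution_def V_def H_def)
    then show thesis
      using that unfolding eventually_ae_filter by auto
  qed
  define W where "W t = V t + \<beta> *\<^sub>R H t" for t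
  \<comment> \<open>\<open>V\<close> is recovered from its almost everywhere derivative by absolute
    continuity, \<open>H\<close> by the fundamental theorem because it is differentiable everywhere.
    Outside \<open>N\<close> the equation identifies the combined integrand with
    \<open>k\<close>.\<close>
  have W_eq: "W T = W t0 + integral {t0..T} k" if T: "T \<ge> t0" for T
  proof -
    have sub: "{t0..T} \<subseteq> {t0..}" by auto
    have "(tderiv t0 V has_integral (V T - V t0)) {t0..T}"
    proof (rule has_integral_abs_continuous[OF V_ac[OF T] T])
      show "negligible N" using N negligible_iff_null_sets by blast
      show "(V has_vector_derivative tderiv t0 V t) (at t within {t0..T})" if "t \<in> {t0..T} - N" for t
        using ode[of t] that has_vector_derivative_within_subset[OF _ sub]
        unfolding tderiv_def by (auto simp: vector_derivative_works)
    qed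
    moreover have "((\<lambda>t. hessian g (x t) (V t)) has_integral (H T - H t0)) {t0..T}"
      by (rule fundamental_theorem_of_calculus[OF T])
        (use has_vector_derivative_within_subset[OF H sub] in auto)
    ultimately have "((\<lambda>t. tderiv t0 V t + \<beta> *\<^sub>R hessian g (x t) (V t)) has_integral
        (V T - V t0 + \<beta> *\<^sub>R (H T - H t0))) {t0..T}"
      by (intro has_integral_add has_integral_cmul)
    then have "(k has_integral (V T - V t0 + \<beta> *\<^sub>R (H T - H t0))) {t0..T}"
    proof (rule has_integral_spike[rotated 2])
      show "negligible N" using N negligible_iff_null_sets by blast
      show "k t = tderiv t0 V t + \<beta> *\<^sub>R hessian g (x t) (V t)" if "t \<in> {t0..T} - N" for t
        using ode[of t] that by (simp add: k_def algebra_simps add_eq_0_iff2)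
    qed
    then show ?thesis
      by (simp add: W_def integral_unique algebra_simps)
  qed
  \<comment> \<open>Since \<open>k\<close> is continuous, its integral has derivative
    \<open>k\<close> at every point, even at times in \<open>N\<close>.\<close>
  have "((\<lambda>T. W t0 + integral {t0..T} k) has_vector_derivative k t) (at t within {t0..t + 1})"
    using integral_has_vector_derivative[of t0 "t + 1" k t] t continuous_on_subset[OF cont_k]
    by (auto intro!: derivative_eq_intros)
  then have "(W has_vector_derivative k t) (at t within {t0..t + 1})"
  proof (rule has_vector_derivative_transform[rotated 2])
    show "W T = W t0 + integral {t0..T} k" if "T \<in> {t0..t + 1}" for T
      using that by (intro W_eq) simp
  qed (use t in simp)
  moreover have "at t within {t0..t + 1} = at t within {t0..}"
    by (rule at_within_nhd[of _ "{..<t + 1}"]) (use t in auto)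
  ultimately show "((\<lambda>t. tderiv t0 x t + \<beta> *\<^sub>R gradient g (x t)) has_vector_derivative
           - ((\<alpha> / t powr q) *\<^sub>R tderiv t0 x t + \<delta> t *\<^sub>R gradient g (x t) + (a / t powr p) *\<^sub>R x t))
         (at t within {t0..})"
    by (simp add: W_def[abs_def] V_def H_def k_def)
qed

section \<open>Dissipation and coercivity of the energy\<close>

text \<open>The left-hand side is the derivative of the energy at \<open>t\<close>, where \<open>P = t\<^sup>q\<close>, \<open>R = t\<^bsup>q-1\<^esup>\<close>, \<open>Q = t\<^bsup>q-2\<^esup>\<close>,
  \<open>Z = t\<^bsup>q-p\<^esup>\<close>, \<open>d = \<delta> t\<close>, \<open>V = x' t\<close>, \<open>D = \<nabla>g(x t)\<close> and \<open>gt = g(x t) - g(x*)\<close>.\<close>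

lemma energy_dissipation_inequality:
  fixes X xs V D :: "'a::real_inner" and \<alpha> \<beta> a p q b P R Z Q d d' K gt :: real
  defines "Y \<equiv> X - xs"
  assumes "\<alpha> > 0" "\<beta> > 0" "a > 0" "0 < q" "q < 1" "q + 1 < p" "0 < b" "b < \<alpha>"
    and P: "P \<ge> 1" and R: "0 < R" "R \<le> 1" and Z: "0 < Z" "Z \<le> 1" and d: "d \<ge> 1"
    and K: "d' * P \<le> K * d * R" and Q: "Q * P = R\<^sup>2" and QZ: "q * (1 - q) * Q \<le> a * Z"
    and small: "2 * q * R \<le> \<alpha> - b" "(K + 2 * q) * R \<le> b / 4"
      "\<beta> * (2 * q + \<alpha> * q) * R \<le> b / 4" "\<beta> * q * R \<le> 1 / 4"
    and gt: "0 \<le> gt" "gt \<le> inner D Y"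
  shows "(d' * P\<^sup>2 + d * (2 * q * (P * R)) - \<beta> * (2 * q * ((q - 1) * Q) * P + (b + 2 * q * R - \<alpha>) * (q * R))) * gt
      + (d * P\<^sup>2 - \<beta> * (b + 2 * q * R - \<alpha>) * P) * inner D V
      + 1/2 * a * ((2 * q - p) * (R * Z) * (norm X)\<^sup>2 + P * Z * (2 * inner X V))
      + inner (b *\<^sub>R Y + P *\<^sub>R (V + \<beta> *\<^sub>R D))
          (b *\<^sub>R V + (q * R) *\<^sub>R (V + \<beta> *\<^sub>R D) - (\<alpha> *\<^sub>R V + (d * P) *\<^sub>R D + (a * Z) *\<^sub>R X))
      + 1/2 * b * (q * (1 - q) * Q * (norm Y)\<^sup>2 + (\<alpha> - b - q * R) * (2 * inner Y V))
    \<le> - (b / 2 * (d * P * gt) + (\<alpha> - b) / 2 * (P * (norm V)\<^sup>2) + \<beta> / 2 * (d * P\<^sup>2 * (norm D)\<^sup>2))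
      + (1/2 * a * b + \<beta> * a\<^sup>2) * (norm xs)\<^sup>2 * Z"
    (is "?L \<le> _")
proof -
  have X: "X = Y + xs" by (simp add: Y_def)
  \<comment> \<open>All products of \<open>V\<close> with \<open>D\<close>, \<open>X\<close> and
    \<open>Y\<close> have cancelled; of \<open>V\<close> only the squared norm is left.\<close>
  have "?L = (d' * P\<^sup>2 + d * (2 * q * (P * R)) - \<beta> * (2 * q * ((q - 1) * Q) * P + (b + 2 * q * R - \<alpha>) * (q * R))) * gt
      - b * (d * P - \<beta> * q * R) * inner D Y
      + 1/2 * b * (q * (1 - q) * Q) * inner Y Y
      - a * b * Z * inner Y X
      - P * (\<alpha> - b - q * R) * inner V V
      - \<beta> * P * (d * P - \<beta> * q * R) * inner D D
      - 1/2 * a * (p - 2 * q) * (R * Z) * inner X X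
      - a * \<beta> * P * Z * inner D X"
    unfolding power2_norm_eq_inner
    by (simp add: inner_simps inner_commute power2_eq_square)
      (simp add: field_simps inner_commute)
  also have "\<dots> \<le> - (b / 2 * (d * P * gt)) + 1/2 * a * b * Z * (norm xs)\<^sup>2 - (\<alpha> - b) / 2 * (P * (norm V)\<^sup>2)
      + (\<beta> * a\<^sup>2 * Z * (norm xs)\<^sup>2 - \<beta> / 2 * (d * P\<^sup>2 * (norm D)\<^sup>2))"
  proof -
    have dP: "d * P \<ge> 1" using mult_mono[of 1 d 1 P] d P by simp
    have "R\<^sup>2 \<le> R" using R by (simp add: power2_eq_square mult_left_le)
    \<comment> \<open>The summand \<open>b * \<beta> * q * R\<close> arises when
      \<open>inner D Y\<close> is replaced by \<open>gt\<close>. Half of the damping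
      \<open>b * d * P\<close> must survive: the terms with \<open>d\<close> use one quarter, those
      with \<open>\<beta>\<close> another, by \<open>d * P >= 1\<close>.\<close>
    have g1: "(d' * P\<^sup>2 + d * (2 * q * (P * R)) - \<beta> * (2 * q * ((q - 1) * Q) * P + (b + 2 * q * R - \<alpha>) * (q * R)))
        + b * \<beta> * q * R \<le> b / 2 * (d * P)"
    proof -
      have "(d' * P\<^sup>2 + d * (2 * q * (P * R)) - \<beta> * (2 * q * ((q - 1) * Q) * P + (b + 2 * q * R - \<alpha>) * (q * R)))
        + b * \<beta> * q * R = d' * P * P + 2 * q * (d * P) * R + \<beta> * (2 * q * (1 - q) * (Q * P) + \<alpha> * q * R - 2 * (q * R)\<^sup>2)"
        by (simp add: power2_eq_square algebra_simps)
      also have "\<dots> \<le> K * d * R * P + 2 * q * (d * P) * R + \<beta> * (2 * q * R + \<alpha> * q * R)"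
      proof -
        have "d' * P * P \<le> K * d * R * P" using K P by (simp add: mult_right_mono)
        moreover
        have "2 * q * (1 - q) * (Q * P) \<le> 2 * q * 1 * R"
          unfolding Q using \<open>0 < q\<close> \<open>q < 1\<close> \<open>R\<^sup>2 \<le> R\<close> R by (intro mult_mono) auto
        then have "2 * q * (1 - q) * (Q * P) + \<alpha> * q * R - 2 * (q * R)\<^sup>2 \<le> 2 * q * R + \<alpha> * q * R"
          using zero_le_power2[of "q * R"] by linarith
        then have "\<beta> * (2 * q * (1 - q) * (Q * P) + \<alpha> * q * R - 2 * (q * R)\<^sup>2) \<le> \<beta> * (2 * q * R + \<alpha> * q * R)"
          using \<open>\<beta> > 0\<close> by (intro mult_left_mono) auto
        ultimately show ?thesis by linarith
      qed
      also have "\<dots> = ((K + 2 * q) * R) * (d * P) + \<beta> * (2 * q + \<alpha> * q) * R"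
        by (simp add: algebra_simps)
      also have "\<dots> \<le> b / 4 * (d * P) + b / 4 * (d * P)"
      proof (rule add_mono)
        show "((K + 2 * q) * R) * (d * P) \<le> b / 4 * (d * P)"
          using small(2) dP by (intro mult_right_mono) auto
        have "b / 4 * 1 \<le> b / 4 * (d * P)"
          using dP \<open>0 < b\<close> by (intro mult_left_mono) auto
        then show "\<beta> * (2 * q + \<alpha> * q) * R \<le> b / 4 * (d * P)"
          using small(3) by linarith
      qed
      finally show ?thesis by linarith
    qed
    have "\<beta> * q * R \<le> d * P / 4" using small(4) dP by linarith
    \<comment> \<open>The factor \<open>d * P - \<beta> * q * R\<close> is nonnegative, so the
      convexity bound \<open>gt <= inner D Y\<close> points the right way.\<close>
    then have DY: "b * (d * P - \<beta> * q * R) * gt \<le> b * (d * P - \<beta> * q * R) * inner D Y"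
      using gt \<open>0 < b\<close> dP by (intro mult_left_mono) auto
    have t1: "(d' * P\<^sup>2 + d * (2 * q * (P * R)) - \<beta> * (2 * q * ((q - 1) * Q) * P + (b + 2 * q * R - \<alpha>) * (q * R))) * gt
      - b * (d * P - \<beta> * q * R) * inner D Y \<le> - (b / 2 * (d * P * gt))"
      using mult_right_mono[OF g1 gt(1)] DY by (simp add: algebra_simps)
    \<comment> \<open>Polarization yields a negative multiple of the squared norm of
      \<open>Y\<close> that absorbs the term with \<open>Q\<close>, thanks to
      \<open>q * (1 - q) * Q <= a * Z\<close>. The only loss is in \<open>xs\<close>.\<close>
    have YX: "2 * inner Y X = inner Y Y + inner X X - inner xs xs"
      unfolding Y_def by (simp add: inner_simps inner_commute)
    have "1/2 * b * (q * (1 - q) * Q) * inner Y Y \<le> 1/2 * b * (a * Z) * inner Y Y"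
      using QZ \<open>0 < b\<close> by (intro mult_right_mono mult_left_mono) auto
    moreover have "0 \<le> 1/2 * a * b * Z * inner X X"
      using \<open>0 < a\<close> \<open>0 < b\<close> Z by simp
    moreover have "a * b * Z * inner Y X = 1/2 * a * b * Z * (inner Y Y + inner X X - inner xs xs)"
      unfolding YX[symmetric] by simp
    ultimately have t2: "1/2 * b * (q * (1 - q) * Q) * inner Y Y - a * b * Z * inner Y X
        \<le> 1/2 * a * b * Z * (norm xs)\<^sup>2"
      unfolding power2_norm_eq_inner by (simp add: algebra_simps)
    have "(\<alpha> - b) / 2 * (P * inner V V) \<le> (\<alpha> - b - q * R) * (P * inner V V)"
      using small(1) P by (intro mult_right_mono) auto
    then have t3: "- P * (\<alpha> - b - q * R) * inner V V \<le> - ((\<alpha> - b) / 2 * (P * (norm V)\<^sup>2))"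
      unfolding power2_norm_eq_inner by (simp add: algebra_simps)
    have t4: "- \<beta> * P * (d * P - \<beta> * q * R) * inner D D - a * \<beta> * P * Z * inner D X
        \<le> \<beta> * a\<^sup>2 * Z * (norm xs)\<^sup>2 - \<beta> / 2 * (d * P\<^sup>2 * (norm D)\<^sup>2)"
    proof -
      \<comment> \<open>As \<open>inner D Y >= 0\<close>, only the \<open>xs\<close> part of
        \<open>inner D X\<close> costs anything. Of the available \<open>d * N^2\<close>, one
        quarter pays for Young's inequality and one for the term with
        \<open>\<beta> * q * R\<close>; half remains.\<close>
      define N where "N = P * norm D"
      have "- (norm D * norm xs) \<le> inner D xs"
        using Cauchy_Schwarz_ineq2[of D xs] by linarith
      moreover have "0 \<le> inner D Y" using gt by linarith
      ultimately have "- (norm D * norm xs) \<le> inner D X"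
        by (simp add: X inner_simps)
      then have "a * P * Z * (- (norm D * norm xs)) \<le> a * P * Z * inner D X"
        using \<open>0 < a\<close> P Z by (intro mult_left_mono) auto
      then have 1: "- (a * P * Z * inner D X) \<le> N * (a * Z * norm xs)"
        by (simp add: N_def algebra_simps)
      have 2: "N * (a * Z * norm xs) \<le> N\<^sup>2 / 4 + (a * Z * norm xs)\<^sup>2"
        using zero_le_power2[of "N / 2 - a * Z * norm xs"] by (simp add: power2_eq_square algebra_simps)
      have 3: "(a * Z * norm xs)\<^sup>2 \<le> a\<^sup>2 * Z * (norm xs)\<^sup>2"
      proof -
        have "Z\<^sup>2 \<le> Z" using Z by (simp add: power2_eq_square mult_left_le)
        from mult_left_mono[OF this, of "a\<^sup>2 * (norm xs)\<^sup>2"] show ?thesis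
          by (simp add: power_mult_distrib mult_ac)
      qed
      have 4: "N\<^sup>2 / 4 \<le> d * N\<^sup>2 / 4" using d by (simp add: mult_le_cancel_right1)
      have "P * (\<beta> * q * R) * (norm D)\<^sup>2 \<le> P * (d * P / 4) * (norm D)\<^sup>2"
        using \<open>\<beta> * q * R \<le> d * P / 4\<close> P by (intro mult_right_mono mult_left_mono) auto
      then have 5: "P * (\<beta> * q * R) * (norm D)\<^sup>2 \<le> d * N\<^sup>2 / 4"
        by (simp add: N_def power2_eq_square algebra_simps)
      have "P * (\<beta> * q * R) * (norm D)\<^sup>2 - d * N\<^sup>2 - a * P * Z * inner D X
          \<le> a\<^sup>2 * Z * (norm xs)\<^sup>2 - d * N\<^sup>2 / 2"
        using 1 2 3 4 5 by linarith
      then have "\<beta> * (P * (\<beta> * q * R) * (norm D)\<^sup>2 - d * N\<^sup>2 - a * P * Z * inner D X)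
          \<le> \<beta> * (a\<^sup>2 * Z * (norm xs)\<^sup>2 - d * N\<^sup>2 / 2)"
        using \<open>\<beta> > 0\<close> by (intro mult_left_mono) auto
      then show ?thesis
        by (simp add: N_def power2_norm_eq_inner[symmetric] power2_eq_square algebra_simps)
    qed
    \<comment> \<open>Here \<open>p > q + 1 > 2 * q\<close>, so the term with the squared norm of
      \<open>X\<close> has a favourable sign and is dropped.\<close>
    have "0 \<le> a * (p - 2 * q) * (R * Z) * inner X X"
      using \<open>0 < a\<close> \<open>q < 1\<close> \<open>q + 1 < p\<close> R Z by (intro mult_nonneg_nonneg) auto
    with t1 t2 t3 t4 show ?thesis by linarith
  qed
  finally show ?thesis by (simp add: algebra_simps)
qed

text \<open>Every unwanted coefficient carries a power of \<open>t\<close> that vanishes at infinity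
  or is dominated by the term with \<open>a\<close>. Hence dissipation and a coercive lower bound
  hold from some \<open>T\<close> on, which may depend on \<open>b\<close>.\<close>

lemma energy_estimates:
  fixes g :: "'a::{real_inner, banach} \<Rightarrow> real" and x :: "real \<Rightarrow> 'a"
  assumes cvx: "convex_on UNIV g" and g: "twice_differentiable g" and "t0 > 0" "\<alpha> > 0" "\<beta> > 0" "a > 0"
    and q: "0 < q" "q < 1"
    and \<delta>_diff: "\<delta> differentiable_on {t0..}"
    and \<delta>_top: "filterlim \<delta> at_top at_top"
    and p: "q + 1 < p" "p \<le> 2" and pa: "p = 2 \<longrightarrow> a \<ge> q * (1 - q)"
    and "K > 0" and K: "eventually (\<lambda>t. t * deriv \<delta> t < K * \<delta> t) at_top"
    and sol: "global_solution g \<delta> \<alpha> \<beta> a p q t0 x0 v0 x"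
    and min: "xstar \<in> argmin g"
    and b: "0 < b" "b < \<alpha>"
  defines "E \<equiv> energy g \<delta> \<alpha> \<beta> a p q t0 x xstar b"
  obtains T E' C where "T > t0" "C \<ge> 0"
    "\<And>t. t \<ge> T \<Longrightarrow> (E has_real_derivative E' t) (at t)"
    "\<And>t. t \<ge> T \<Longrightarrow> E' t \<le> - (b / 2 * (\<delta> t * t powr q * (g (x t) - g xstar))
        + (\<alpha> - b) / 2 * (t powr q * (norm (tderiv t0 x t))\<^sup>2)
        + \<beta> / 2 * (\<delta> t * t powr (2 * q) * (norm (gradient g (x t)))\<^sup>2)) + C * t powr (q - p)"
    "\<And>t. t \<ge> T \<Longrightarrow> \<delta> t * t powr (2 * q) * (g (x t) - g xstar)
        + 1/2 * (norm (b *\<^sub>R (x t - xstar) + t powr q *\<^sub>R (tderiv t0 x t + \<beta> *\<^sub>R gradient g (x t))))\<^sup>2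
        + b * (\<alpha> - b) / 4 * (norm (x t - xstar))\<^sup>2 \<le> E t"
    "\<And>t. t \<ge> T \<Longrightarrow> \<delta> t \<ge> 1"
proof -
  define V where "V = tderiv t0 x"
  define D where "D t = gradient g (x t)" for t
  define W where "W t = V t + \<beta> *\<^sub>R D t" for t
  define k where "k t = - ((\<alpha> / t powr q) *\<^sub>R V t + \<delta> t *\<^sub>R D t + (a / t powr p) *\<^sub>R x t)" for t
  define C where "C = (1/2 * a * b + \<beta> * a\<^sup>2) * (norm xstar)\<^sup>2"
  have C: "C \<ge> 0" using \<open>a > 0\<close> b \<open>\<beta> > 0\<close> by (simp add: C_def)
  have gx: "g differentiable (at y)" for y using g by (simp add: twice_differentiable_def)
  have gt: "0 \<le> g y - g xstar" for y
    using min by (simp add: argmin_def is_arg_min_linorder)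
  have gradient_ineq: "g (x t) - g xstar \<le> inner (D t) (x t - xstar)" for t
    using convex_gradient_inequality[OF cvx gx, of "x t" xstar] by (simp add: D_def inner_simps)
  have \<delta>_cont: "continuous_on {t0..} \<delta>"
    using \<delta>_diff by (rule differentiable_imp_continuous_on)
  have at: "at t within {t0..} = at t" if "t > t0" for t
    using that by (intro at_within_interior) simp
  have dx: "(x has_vector_derivative V t) (at t)"
    and dW: "(W has_vector_derivative k t) (at t)"
    and d\<delta>: "(\<delta> has_real_derivative deriv \<delta> t) (at t)"
    and dg: "((\<lambda>t. g (x t)) has_real_derivative inner (D t) (V t)) (at t)" if t: "t > t0" for t
  proof -
    note fo = global_solution_first_order[OF g \<open>t0 > 0\<close> \<delta>_cont sol less_imp_le[OF t], unfolded at[OF t]]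
    show dx: "(x has_vector_derivative V t) (at t)"
      using fo(1) by (simp add: V_def)
    show "(W has_vector_derivative k t) (at t)"
      using fo(3) by (simp add: W_def[abs_def] V_def D_def k_def)
    show "(\<delta> has_real_derivative deriv \<delta> t) (at t)"
      using \<delta>_diff t at[OF t] unfolding differentiable_on_def
      by (metis DERIV_deriv_iff_real_differentiable atLeast_iff less_imp_le)
    have "((\<lambda>t. g (x t)) has_derivative (\<lambda>s. inner (s *\<^sub>R V t) (D t))) (at t)"
      using dx GDERIV_gradient[OF gx, of "x t"] unfolding has_vector_derivative_def gderiv_def D_def
      by (rule has_derivative_compose)
    then show "((\<lambda>t. g (x t)) has_real_derivative inner (D t) (V t)) (at t)"
      by (simp add: has_field_derivative_def inner_commute mult_commute_abs)
  qed
  \<comment> \<open>The product rule, with \<open>W\<close> differentiated as one block with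
    derivative \<open>k\<close>, so that no Hessian occurs.\<close>
  define E' where "E' t =
      (deriv \<delta> t * t powr (2 * q) + \<delta> t * (2 * q * t powr (2 * q - 1))
         - \<beta> * (2 * q * ((q - 1) * t powr (q - 2)) * t powr q + (b + 2 * q * t powr (q - 1) - \<alpha>) * (q * t powr (q - 1))))
         * (g (x t) - g xstar)
      + (\<delta> t * t powr (2 * q) - \<beta> * (b + 2 * q * t powr (q - 1) - \<alpha>) * t powr q) * inner (D t) (V t)
      + 1/2 * a * ((2 * q - p) * t powr (2 * q - p - 1) * (norm (x t))\<^sup>2 + t powr (2 * q - p) * (2 * inner (x t) (V t)))
      + inner (b *\<^sub>R (x t - xstar) + t powr q *\<^sub>R W t) (b *\<^sub>R V t + (q * t powr (q - 1)) *\<^sub>R W t + t powr q *\<^sub>R k t)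
      + 1/2 * b * (q * (1 - q) * t powr (q - 2) * (norm (x t - xstar))\<^sup>2
         + (\<alpha> - b - q * t powr (q - 1)) * (2 * inner (x t - xstar) (V t)))" for t
  have dE: "(E has_real_derivative E' t) (at t)" if t: "t > t0" for t
  proof -
    have t_pos: "t > 0" using t \<open>t0 > 0\<close> by simp
    have dpowr: "((\<lambda>t. t powr r) has_real_derivative r * t powr (r - 1)) (at t)" for r
      using t_pos by (rule has_real_derivative_powr)
    have dpowr1: "((\<lambda>t. t powr (q - 1)) has_real_derivative (q - 1) * t powr (q - 2)) (at t)"
      using dpowr[of "q - 1"] by simp
    have dsq: "((\<lambda>t. (norm (u t))\<^sup>2) has_real_derivative 2 * inner (u t) u') (at t)"
      if "(u has_vector_derivative u') (at t)" for u :: "real \<Rightarrow> 'a" and u'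
    proof -
      have "((\<lambda>t. inner (u t) (u t)) has_derivative (\<lambda>s. inner (u t) (s *\<^sub>R u') + inner (s *\<^sub>R u') (u t))) (at t)"
        using that unfolding has_vector_derivative_def by (intro has_derivative_inner)
      then show ?thesis
        unfolding power2_norm_eq_inner has_field_derivative_def
        by (rule has_derivative_eq_rhs) (auto simp: inner_commute)
    qed
    have dY: "((\<lambda>t. x t - xstar) has_vector_derivative V t) (at t)"
      using has_vector_derivative_diff[OF dx[OF t] has_vector_derivative_const] by simp
    have dv: "((\<lambda>t. b *\<^sub>R (x t - xstar) + t powr q *\<^sub>R W t) has_vector_derivative
        (b *\<^sub>R V t + (q * t powr (q - 1)) *\<^sub>R W t + t powr q *\<^sub>R k t)) (at t)"
    proof -
      have "((\<lambda>t. b *\<^sub>R (x t - xstar)) has_vector_derivative b *\<^sub>R V t) (at t)"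
        using has_vector_derivative_scaleR[OF DERIV_const[of b] dY] by simp
      from has_vector_derivative_add[OF this has_vector_derivative_scaleR[OF dpowr dW[OF t], of q]]
      show ?thesis by (simp add: algebra_simps)
    qed
    show ?thesis
      unfolding E_def energy_def[abs_def] V_def[symmetric] D_def[symmetric] W_def[symmetric]
      by (rule derivative_eq_intros refl d\<delta>[OF t] dg[OF t] dpowr dpowr1 dsq[OF dx[OF t]] dsq[OF dY] dsq[OF dv])+
        (simp add: E'_def algebra_simps)
  qed
  have R0: "((\<lambda>t. t powr (q - 1)) \<longlongrightarrow> 0) at_top"
    by (rule tendsto_neg_powr[OF _ filterlim_ident]) (use q in simp)
  have small: "\<forall>\<^sub>F t in at_top. c * t powr (q - 1) < e" if "e > 0" for c e :: real
    using tendsto_mult_right_zero[OF R0, of c] that by (rule order_tendstoD(2))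
  \<comment> \<open>Divided by \<open>t powr (q - p)\<close>, the claim is
    \<open>q * (1 - q) * t powr (p - 2) <= a\<close>. The left side tends to 0 if
    \<open>p < 2\<close>; if \<open>p = 2\<close> the assumption on \<open>a\<close> takes
    over.\<close>
  have QZ: "\<forall>\<^sub>F t in at_top. q * (1 - q) * t powr (q - 2) \<le> a * t powr (q - p)"
  proof (cases "p = 2")
    case True
    then show ?thesis using pa by (auto intro!: always_eventually mult_right_mono)
  next
    case False
    have "((\<lambda>t. t powr (p - 2)) \<longlongrightarrow> 0) at_top"
      by (rule tendsto_neg_powr[OF _ filterlim_ident]) (use False p in simp)
    then have "\<forall>\<^sub>F t in at_top. q * (1 - q) * t powr (p - 2) < a"
      using order_tendstoD(2)[OF tendsto_mult_right_zero \<open>a > 0\<close>] by blast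
    then show ?thesis
    proof eventually_elim
      case (elim t)
      then have "q * (1 - q) * t powr (p - 2) * t powr (q - p) \<le> a * t powr (q - p)"
        by (intro mult_right_mono) auto
      then show ?case by (simp add: mult.assoc flip: powr_add)
    qed
  qed
  have "\<forall>\<^sub>F t in at_top. t \<ge> 1 \<and> t > t0 \<and> \<delta> t \<ge> 1 \<and> t * deriv \<delta> t < K * \<delta> t \<and>
      q * (1 - q) * t powr (q - 2) \<le> a * t powr (q - p) \<and>
      2 * q * t powr (q - 1) < \<alpha> - b \<and> (K + 2 * q) * t powr (q - 1) < b / 4 \<and>
      \<beta> * (2 * q + \<alpha> * q) * t powr (q - 1) < b / 4 \<and> \<beta> * q * t powr (q - 1) < 1 / 4"
    using b \<delta>_top
    by (intro eventually_conj small K QZ eventually_ge_at_top eventually_gt_at_top)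
      (auto simp: filterlim_at_top)
  then obtain T where T: "\<And>t. t \<ge> T \<Longrightarrow> t \<ge> 1 \<and> t > t0 \<and> \<delta> t \<ge> 1 \<and> t * deriv \<delta> t < K * \<delta> t \<and>
      q * (1 - q) * t powr (q - 2) \<le> a * t powr (q - p) \<and>
      2 * q * t powr (q - 1) < \<alpha> - b \<and> (K + 2 * q) * t powr (q - 1) < b / 4 \<and>
      \<beta> * (2 * q + \<alpha> * q) * t powr (q - 1) < b / 4 \<and> \<beta> * q * t powr (q - 1) < 1 / 4"
    unfolding eventually_at_top_linorder by blast
  show thesis
  proof (rule that)
    show "T > t0" using T[of T] by simp
    show "C \<ge> 0" by fact
    show "(E has_real_derivative E' t) (at t)" if "t \<ge> T" for t using dE T[OF that] by simp
    show "\<delta> t \<ge> 1" if "t \<ge> T" for t using T[OF that] by simp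
    fix t assume t: "t \<ge> T"
    then have t1: "t \<ge> 1" "t > 0" using T by force+
    define P R Z where "P = t powr q" and "R = t powr (q - 1)" and "Z = t powr (q - p)"
    have P: "P \<ge> 1" and R: "0 < R" "R \<le> 1" and Z: "0 < Z" "Z \<le> 1"
      using t1 q p powr_mono[of 0 q t] powr_mono[of "q - 1" 0 t] powr_mono[of "q - p" 0 t]
      by (auto simp: P_def R_def Z_def)
    have tR: "P = t * R"
      using t1 powr_add[of t 1 "q - 1"] by (simp add: P_def R_def)
    have exps: "t powr (2 * q) = P\<^sup>2" "t powr (2 * q - 1) = P * R" "t powr (2 * q - p - 1) = R * Z"
      "t powr (2 * q - p) = P * Z" "t powr (q - 2) * P = R\<^sup>2"
      by (auto simp: P_def R_def Z_def power2_eq_square algebra_simps simp flip: powr_add)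
    \<comment> \<open>The factor \<open>P\<close> cancels \<open>t powr q\<close> in the damping
      coefficient and turns \<open>a / t powr p\<close> into \<open>a * Z\<close>.\<close>
    have "P *\<^sub>R k t = - (\<alpha> *\<^sub>R V t + (\<delta> t * P) *\<^sub>R D t + (a * Z) *\<^sub>R x t)"
      using t1 P by (simp add: k_def P_def Z_def powr_diff algebra_simps)
    then have v': "b *\<^sub>R V t + (q * R) *\<^sub>R W t + P *\<^sub>R k t
        = b *\<^sub>R V t + (q * R) *\<^sub>R (V t + \<beta> *\<^sub>R D t) - (\<alpha> *\<^sub>R V t + (\<delta> t * P) *\<^sub>R D t + (a * Z) *\<^sub>R x t)"
      by (simp add: W_def)
    \<comment> \<open>With \<open>P = t * R\<close>, the growth condition on \<open>\<delta>\<close>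
      times \<open>R\<close> becomes the form that the dissipation inequality asks for.\<close>
    have "t * deriv \<delta> t * R \<le> K * \<delta> t * R"
      using T[OF t] R by (intro mult_right_mono) auto
    then have K: "deriv \<delta> t * P \<le> K * \<delta> t * R" by (simp add: tR algebra_simps)
    have "E' t \<le> - (b / 2 * (\<delta> t * P * (g (x t) - g xstar)) + (\<alpha> - b) / 2 * (P * (norm (V t))\<^sup>2)
        + \<beta> / 2 * (\<delta> t * P\<^sup>2 * (norm (D t))\<^sup>2)) + C * Z"
      unfolding E'_def exps C_def W_def v'[unfolded W_def R_def P_def]
      unfolding R_def[symmetric] P_def[symmetric]
      by (rule energy_dissipation_inequality[where K = K])
        (use T[OF t] K exps gt[of "x t"] gradient_ineq[of t] P R Z b q p \<open>\<alpha> > 0\<close> \<open>\<beta> > 0\<close> \<open>a > 0\<close>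
          in \<open>auto simp: P_def R_def Z_def\<close>)
    then show "E' t \<le> - (b / 2 * (\<delta> t * t powr q * (g (x t) - g xstar))
        + (\<alpha> - b) / 2 * (t powr q * (norm (tderiv t0 x t))\<^sup>2)
        + \<beta> / 2 * (\<delta> t * t powr (2 * q) * (norm (gradient g (x t)))\<^sup>2)) + C * t powr (q - p)"
      by (simp add: exps D_def V_def flip: P_def Z_def)
    \<comment> \<open>This bound makes the correction in the first energy coefficient nonnegative
      and keeps the last coefficient at least \<open>b * (\<alpha> - b) / 4\<close>.\<close>
    have qR: "2 * q * R < \<alpha> - b" using T[OF t] by (simp add: R_def)
    have "0 \<le> \<beta> * (\<alpha> - b - 2 * q * R) * P * (g (x t) - g xstar)"
      using qR \<open>\<beta> > 0\<close> P gt[of "x t"] by (intro mult_nonneg_nonneg) auto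
    moreover have "0 \<le> 1/2 * a * (P * Z) * (norm (x t))\<^sup>2"
      using \<open>a > 0\<close> P Z by (intro mult_nonneg_nonneg) auto
    moreover have "b * (\<alpha> - b) / 4 * (norm (x t - xstar))\<^sup>2 \<le> 1/2 * b * (\<alpha> - b - q * R) * (norm (x t - xstar))\<^sup>2"
    proof (rule mult_right_mono)
      have "b * ((\<alpha> - b) / 2) \<le> b * (\<alpha> - b - q * R)"
        using qR b by (intro mult_left_mono) auto
      then show "b * (\<alpha> - b) / 4 \<le> 1/2 * b * (\<alpha> - b - q * R)" by simp
    qed simp
    moreover have "(\<delta> t * P\<^sup>2 - \<beta> * (b + 2 * q * R - \<alpha>) * P) * (g (x t) - g xstar)
        = \<delta> t * P\<^sup>2 * (g (x t) - g xstar) + \<beta> * (\<alpha> - b - 2 * q * R) * P * (g (x t) - g xstar)"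
      by (simp add: algebra_simps)
    ultimately show "\<delta> t * t powr (2 * q) * (g (x t) - g xstar)
        + 1/2 * (norm (b *\<^sub>R (x t - xstar) + t powr q *\<^sub>R (tderiv t0 x t + \<beta> *\<^sub>R gradient g (x t))))\<^sup>2
        + b * (\<alpha> - b) / 4 * (norm (x t - xstar))\<^sup>2 \<le> E t"
      unfolding E_def energy_def exps P_def[symmetric] R_def[symmetric]
      by linarith
  qed
qed

section \<open>Monotone limits and integrability from dissipation\<close>

lemma tendsto_antimono_at_top:
  fixes f :: "real \<Rightarrow> real"
  assumes anti: "\<And>s t. T \<le> s \<Longrightarrow> s \<le> t \<Longrightarrow> f t \<le> f s" and bdd: "\<And>t. T \<le> t \<Longrightarrow> B \<le> f t"
  shows "\<exists>L. (f \<longlongrightarrow> L) at_top"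
proof
  let ?L = "INF t\<in>{T..}. f t"
  have bdd': "bdd_below (f ` {T..})" using bdd by (auto simp: bdd_below_def)
  show "(f \<longlongrightarrow> ?L) at_top"
  proof (rule decreasing_tendsto)
    show "\<forall>\<^sub>F t in at_top. ?L \<le> f t"
      using eventually_ge_at_top[of T] by eventually_elim (auto intro!: cINF_lower bdd')
    fix y assume "?L < y"
    then obtain s where s: "s \<ge> T" "f s < y"
      using cINF_less_iff[OF _ bdd'] by auto
    show "\<forall>\<^sub>F t in at_top. f t < y"
      using eventually_ge_at_top[of s]
    proof eventually_elim
      case (elim t)
      show ?case using anti[OF s(1) elim] s(2) by linarith
    qed
  qed
qed

lemma antimono_if_derivative_nonpos:
  fixes \<Phi> :: "real \<Rightarrow> real"
  assumes "\<And>t. t \<ge> T \<Longrightarrow> (\<Phi> has_real_derivative \<Phi>' t) (at t)" "\<And>t. t \<ge> T \<Longrightarrow> \<Phi>' t \<le> 0"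
    and "T \<le> s" "s \<le> t"
  shows "\<Phi> t \<le> \<Phi> s"
  using DERIV_nonpos_imp_nonincreasing[OF \<open>s \<le> t\<close>, of \<Phi>] assms by (meson order_trans)

text \<open>From \<open>T\<close> on, \<open>\<Phi> / c\<close> loses at least what the integral of
  \<open>f\<close> gains. As \<open>\<Phi>\<close> is bounded below, the integral is bounded; as
  \<open>f\<close> is nonnegative, it increases and so converges.\<close>

lemma set_integrable_if_dissipated:
  fixes f \<Phi> :: "real \<Rightarrow> real"
  assumes cont: "continuous_on {t0..} f" and "t0 < T" and "c > 0"
    and nonneg: "\<And>t. t \<ge> T \<Longrightarrow> 0 \<le> f t"
    and deriv: "\<And>t. t \<ge> T \<Longrightarrow> (\<Phi> has_real_derivative \<Phi>' t) (at t)"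
    and diss: "\<And>t. t \<ge> T \<Longrightarrow> \<Phi>' t \<le> - (c * f t)"
    and bdd: "\<And>t. t \<ge> T \<Longrightarrow> B \<le> \<Phi> t"
  shows "set_integrable lborel {t0..} f"
proof -
  \<comment> \<open>Freezing \<open>f\<close> before \<open>T\<close> gives a function that is
    continuous, hence Borel, and nonnegative on the whole line.\<close>
  define h where "h t = f (max T t)" for t
  define S where "S t = integral {t0..t} h" for t
  have cont_h: "continuous_on A h" for A
  proof -
    have "continuous_on A (f \<circ> max T)"
    proof (rule continuous_on_compose)
      show "continuous_on (max T ` A) f"
        by (rule continuous_on_subset[OF cont]) (use \<open>t0 < T\<close> in auto)
    qed (intro continuous_intros)
    then show ?thesis by (simp add: h_def[abs_def] comp_def)
  qed
  have dS: "(S has_real_derivative h t) (at t)" if "t \<ge> T" for t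
  proof -
    have "(S has_real_derivative h t) (at t within {t0..t + 1})"
      unfolding S_def using that \<open>t0 < T\<close>
      by (intro integral_has_real_derivative cont_h) auto
    moreover have "at t within {t0..t + 1} = at t"
      using that \<open>t0 < T\<close> by (intro at_within_interior) simp
    ultimately show ?thesis by simp
  qed
  have anti: "S t + \<Phi> t / c \<le> S s + \<Phi> s / c" if "T \<le> s" "s \<le> t" for s t
  proof (rule antimono_if_derivative_nonpos[OF _ _ that])
    show "((\<lambda>t. S t + \<Phi> t / c) has_real_derivative h t + \<Phi>' t / c) (at t)" if "t \<ge> T" for t
      using dS[OF that] deriv[OF that] \<open>c > 0\<close> by (auto intro!: derivative_eq_intros)
    show "h t + \<Phi>' t / c \<le> 0" if "t \<ge> T" for t
      using diss[OF that] that \<open>c > 0\<close> by (simp add: h_def max_def field_simps)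
  qed
  have "\<exists>L. ((\<lambda>t. - S t) \<longlongrightarrow> L) at_top"
  proof (rule tendsto_antimono_at_top)
    show "- S t \<le> - S s" if "T \<le> s" "s \<le> t" for s t
      by (rule antimono_if_derivative_nonpos[OF _ _ that, of _ "\<lambda>t. - h t"])
        (use dS nonneg in \<open>auto simp: h_def intro!: DERIV_minus\<close>)
    show "B / c - (S T + \<Phi> T / c) \<le> - S t" if "T \<le> t" for t
      using anti[OF _ that] divide_right_mono[OF bdd[OF that], of c] \<open>c > 0\<close> by simp
  qed
  then obtain L where "((\<lambda>t. - S t) \<longlongrightarrow> L) at_top" ..
  then have L: "(S \<longlongrightarrow> - L) at_top"
    using tendsto_minus by fastforce
  have h_borel: "h \<in> borel_measurable borel"
    using cont_h by (rule borel_measurable_continuous_onI)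
  have h_nonneg: "0 \<le> h t" for t by (simp add: h_def nonneg)
  have "(\<integral>\<^sup>+t. ennreal (indicator {T..} t * h t) \<partial>lborel) = (\<integral>\<^sup>+t. ennreal (h t) * indicator {T..} t \<partial>lborel)"
    by (intro nn_integral_cong) (simp split: split_indicator)
  also have "\<dots> = - L - S T"
    using nn_integral_FTC_atLeast[OF h_borel dS h_nonneg L] by simp
  finally have "set_integrable lborel {T..} h"
    unfolding set_integrable_def
    by (intro integrableI_nonneg) (use h_borel h_nonneg in auto)
  moreover have "set_integrable lborel {T..} h = set_integrable lborel {T..} f"
    by (rule set_integrable_cong) (auto simp: h_def)
  \<comment> \<open>Before \<open>T\<close> neither sign nor dissipation is known; continuity on a
    compact interval suffices.\<close>
  moreover have "set_integrable lborel {t0..T} f"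
    by (rule borel_integrable_atLeastAtMost') (rule continuous_on_subset[OF cont], auto)
  ultimately have "set_integrable lborel ({t0..T} \<union> {T..}) f"
    by (intro set_integrable_Un) auto
  moreover have "{t0..T} \<union> {T..} = {t0..}" using \<open>t0 < T\<close> by auto
  ultimately show ?thesis by simp
qed

section \<open>Bounds, integrals and the limit of the energy\<close>

theorem theorem3p2:
  fixes g :: "'a::{real_inner, banach} \<Rightarrow> real"
    and \<delta> :: "real \<Rightarrow> real"
    and \<alpha> \<beta> a p q t0 :: real
    and x :: "real \<Rightarrow> 'a"
    and x0 v0 xstar :: 'a
  assumes "convex_on UNIV g"
    and "twice_differentiable g"
    and "t0 > 0" and "\<alpha> > 0" and "\<beta> > 0" and "a > 0" and "p > 0" and "0 < q" and "q < 1"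
    and "\<forall>t\<ge>t0. \<delta> t > 0"
    and "\<delta> differentiable_on {t0..}"
    and "mono_on {t0..} \<delta>"
    and "filterlim \<delta> at_top at_top"
    and "q + 1 < p" and "p \<le> 2"
    and "p = 2 \<longrightarrow> a \<ge> q * (1 - q)"
    and "\<exists>K1>0. eventually (\<lambda>t. t * deriv \<delta> t < K1 * \<delta> t) at_top"
    and "global_solution g \<delta> \<alpha> \<beta> a p q t0 x0 v0 x"
    and "xstar \<in> argmin g"
  shows "bounded (x ` {t0..})
    \<and> (\<lambda>t. g (x t) - g xstar) \<in> O[at_top](\<lambda>t. 1 / (\<delta> t * t powr (2 * q)))
    \<and> (\<lambda>t. norm (tderiv t0 x t + \<beta> *\<^sub>R gradient g (x t))) \<in> O[at_top](\<lambda>t. 1 / t powr q)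
    \<and> set_integrable lborel {t0..} (\<lambda>t. \<delta> t * t powr q * (g (x t) - g xstar))
    \<and> set_integrable lborel {t0..} (\<lambda>t. t powr (q - p) * (norm (x t))\<^sup>2)
    \<and> set_integrable lborel {t0..} (\<lambda>t. t powr q * (norm (tderiv t0 x t))\<^sup>2)
    \<and> set_integrable lborel {t0..} (\<lambda>t. \<delta> t * t powr (2 * q) * (norm (gradient g (x t)))\<^sup>2)
    \<and> set_integrable lborel {t0..} (\<lambda>t. t powr (q - p) * (norm (x t - xstar))\<^sup>2)
    \<and> (\<forall>b. 0 < b \<and> b < \<alpha> \<longrightarrow>
          (\<exists>L. (energy g \<delta> \<alpha> \<beta> a p q t0 x xstar b \<longlongrightarrow> L) at_top))"
proof -
  obtain K where K: "K > 0" "eventually (\<lambda>t. t * deriv \<delta> t < K * \<delta> t) at_top"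
    using assms by blast
  define E where "E = energy g \<delta> \<alpha> \<beta> a p q t0 x xstar"
  define v where "v b t = b *\<^sub>R (x t - xstar) + t powr q *\<^sub>R (tderiv t0 x t + \<beta> *\<^sub>R gradient g (x t))" for b t
  define tail where "tail t = t powr (q - p + 1) / (p - q - 1)" for t
  have tail_nonneg: "tail t \<ge> 0" for t using \<open>q + 1 < p\<close> by (simp add: tail_def)
  have d_tail: "(tail has_real_derivative - (t powr (q - p))) (at t)" if "t > t0" for t
  proof -
    have "((\<lambda>t. t powr (q - p + 1)) has_real_derivative (q - p + 1) * t powr (q - p)) (at t)"
      using has_real_derivative_powr[of t "q - p + 1"] that \<open>t0 > 0\<close> by simp
    from DERIV_cdivide[OF this, of "p - q - 1"] show ?thesis
      unfolding tail_def[abs_def]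
      by (rule DERIV_cong) (use \<open>q + 1 < p\<close> in \<open>simp add: divide_eq_eq algebra_simps\<close>)
  qed
  \<comment> \<open>The exponent is negative by \<open>q + 1 < p\<close>. Since \<open>tail\<close>
    vanishes at infinity, the limit passes from \<open>E b t + C * tail t\<close> to
    \<open>E b t\<close>.\<close>
  have tail_lim: "(tail \<longlongrightarrow> 0) at_top"
    unfolding tail_def[abs_def] using \<open>q + 1 < p\<close>
    by (intro tendsto_divide_zero tendsto_neg_powr[OF _ filterlim_ident]) simp
  have gt: "0 \<le> g y - g xstar" for y
    using assms by (simp add: argmin_def is_arg_min_linorder)
  have \<delta>_cont: "continuous_on {t0..} \<delta>"
    using assms differentiable_imp_continuous_on by blast
  note fo = global_solution_first_order[OF \<open>twice_differentiable g\<close> \<open>t0 > 0\<close> \<delta>_cont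
      \<open>global_solution g \<delta> \<alpha> \<beta> a p q t0 x0 v0 x\<close>]
  have cont_x: "continuous_on {t0..} x"
    by (rule continuous_on_vector_derivative) (use fo(1) in auto)
  have cont_V: "continuous_on {t0..} (tderiv t0 x)"
    using fo(2) by blast
  have "continuous_on UNIV g" "continuous_on UNIV (gradient g)"
    using \<open>twice_differentiable g\<close>
    by (auto simp: twice_differentiable_def differentiable_on_def intro!: differentiable_imp_continuous_on)
  then have cont_g: "continuous_on {t0..} (\<lambda>t. g (x t))"
    and cont_D: "continuous_on {t0..} (\<lambda>t. gradient g (x t))"
    by (auto intro: continuous_on_compose2[OF _ cont_x])
  \<comment> \<open>Stated for every \<open>b\<close>: the limit concerns all of them, the bounds
    and integrals are read off from a single one.\<close>
  have decay: "\<exists>T \<Phi>' C. T > t0 \<and> C \<ge> 0 \<and>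
      (\<forall>t\<ge>T. ((\<lambda>t. E b t + C * tail t) has_real_derivative \<Phi>' t) (at t) \<and> \<delta> t \<ge> 1 \<and>
        \<Phi>' t \<le> - (b / 2 * (\<delta> t * t powr q * (g (x t) - g xstar))
          + (\<alpha> - b) / 2 * (t powr q * (norm (tderiv t0 x t))\<^sup>2)
          + \<beta> / 2 * (\<delta> t * t powr (2 * q) * (norm (gradient g (x t)))\<^sup>2)) \<and>
        \<delta> t * t powr (2 * q) * (g (x t) - g xstar) + 1/2 * (norm (v b t))\<^sup>2
          + b * (\<alpha> - b) / 4 * (norm (x t - xstar))\<^sup>2 \<le> E b t + C * tail t)"
    if b: "0 < b" "b < \<alpha>" for b
  proof -
    obtain T E' C where *: "T > t0" "C \<ge> 0"
      "\<And>t. t \<ge> T \<Longrightarrow> (E b has_real_derivative E' t) (at t)"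
      "\<And>t. t \<ge> T \<Longrightarrow> E' t \<le> - (b / 2 * (\<delta> t * t powr q * (g (x t) - g xstar))
          + (\<alpha> - b) / 2 * (t powr q * (norm (tderiv t0 x t))\<^sup>2)
          + \<beta> / 2 * (\<delta> t * t powr (2 * q) * (norm (gradient g (x t)))\<^sup>2)) + C * t powr (q - p)"
      "\<And>t. t \<ge> T \<Longrightarrow> \<delta> t * t powr (2 * q) * (g (x t) - g xstar) + 1/2 * (norm (v b t))\<^sup>2
          + b * (\<alpha> - b) / 4 * (norm (x t - xstar))\<^sup>2 \<le> E b t"
      "\<And>t. t \<ge> T \<Longrightarrow> \<delta> t \<ge> 1"
      unfolding E_def v_def
      using energy_estimates[OF assms(1-6) assms(8,9,11,13-16) K assms(18,19) b] by metis
    show ?thesis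
    proof (rule exI[of _ T], rule exI[of _ "\<lambda>t. E' t - C * t powr (q - p)"], rule exI[of _ C],
        intro conjI allI impI)
      fix t assume t: "T \<le> t"
      show "((\<lambda>t. E b t + C * tail t) has_real_derivative E' t - C * t powr (q - p)) (at t)"
        using *(1) *(3)[OF t] d_tail[of t] t by (auto intro!: derivative_eq_intros)
      show "E' t - C * t powr (q - p) \<le> - (b / 2 * (\<delta> t * t powr q * (g (x t) - g xstar))
          + (\<alpha> - b) / 2 * (t powr q * (norm (tderiv t0 x t))\<^sup>2)
          + \<beta> / 2 * (\<delta> t * t powr (2 * q) * (norm (gradient g (x t)))\<^sup>2))"
        using *(4)[OF t] by linarith
      have "0 \<le> C * tail t" using *(2) tail_nonneg by simp
      then show "\<delta> t * t powr (2 * q) * (g (x t) - g xstar) + 1/2 * (norm (v b t))\<^sup>2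
          + b * (\<alpha> - b) / 4 * (norm (x t - xstar))\<^sup>2 \<le> E b t + C * tail t"
        using *(5)[OF t] by linarith
    qed (use * in auto)
  qed
  have limit: "\<exists>L. (E b \<longlongrightarrow> L) at_top" if b: "0 < b" "b < \<alpha>" for b
  proof -
    obtain T \<Phi>' C where T: "T > t0" and
      *: "\<And>t. t \<ge> T \<Longrightarrow> ((\<lambda>t. E b t + C * tail t) has_real_derivative \<Phi>' t) (at t) \<and> \<delta> t \<ge> 1 \<and>
        \<Phi>' t \<le> - (b / 2 * (\<delta> t * t powr q * (g (x t) - g xstar))
          + (\<alpha> - b) / 2 * (t powr q * (norm (tderiv t0 x t))\<^sup>2)
          + \<beta> / 2 * (\<delta> t * t powr (2 * q) * (norm (gradient g (x t)))\<^sup>2)) \<and>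
        \<delta> t * t powr (2 * q) * (g (x t) - g xstar) + 1/2 * (norm (v b t))\<^sup>2
          + b * (\<alpha> - b) / 4 * (norm (x t - xstar))\<^sup>2 \<le> E b t + C * tail t"
      using decay[OF b] by blast
    have "\<exists>L. ((\<lambda>t. E b t + C * tail t) \<longlongrightarrow> L) at_top"
    proof (rule tendsto_antimono_at_top)
      show "E b t + C * tail t \<le> E b s + C * tail s" if "T \<le> s" "s \<le> t" for s t
      proof (rule antimono_if_derivative_nonpos[OF _ _ that])
        fix t assume t: "t \<ge> T"
        have "0 \<le> b / 2 * (\<delta> t * t powr q * (g (x t) - g xstar))
          + (\<alpha> - b) / 2 * (t powr q * (norm (tderiv t0 x t))\<^sup>2)
          + \<beta> / 2 * (\<delta> t * t powr (2 * q) * (norm (gradient g (x t)))\<^sup>2)"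
          using b \<open>\<beta> > 0\<close> *[OF t] gt[of "x t"] by (intro add_nonneg_nonneg mult_nonneg_nonneg) auto
        then show "\<Phi>' t \<le> 0" using *[OF t] by linarith
      qed (use * in blast)
      fix t assume t: "t \<ge> T"
      have "0 \<le> \<delta> t * t powr (2 * q) * (g (x t) - g xstar) + 1/2 * (norm (v b t))\<^sup>2
          + b * (\<alpha> - b) / 4 * (norm (x t - xstar))\<^sup>2"
        using b *[OF t] gt[of "x t"] by (intro add_nonneg_nonneg mult_nonneg_nonneg) auto
      then show "0 \<le> E b t + C * tail t" using *[OF t] by linarith
    qed
    then obtain L where "((\<lambda>t. E b t + C * tail t) \<longlongrightarrow> L) at_top" ..
    from tendsto_diff[OF this tendsto_mult_right_zero[OF tail_lim, of C]]
    show ?thesis by auto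
  qed
  \<comment> \<open>The remaining claims do not mention \<open>b\<close>; the midpoint makes both
    \<open>b\<close> and \<open>\<alpha> - b\<close> positive.\<close>
  define b where "b = \<alpha> / 2"
  have b: "0 < b" "b < \<alpha>" using \<open>\<alpha> > 0\<close> by (auto simp: b_def)
  obtain T \<Phi>' C where T: "T > t0" and
    *: "\<And>t. t \<ge> T \<Longrightarrow> ((\<lambda>t. E b t + C * tail t) has_real_derivative \<Phi>' t) (at t) \<and> \<delta> t \<ge> 1 \<and>
      \<Phi>' t \<le> - (b / 2 * (\<delta> t * t powr q * (g (x t) - g xstar))
        + (\<alpha> - b) / 2 * (t powr q * (norm (tderiv t0 x t))\<^sup>2)
        + \<beta> / 2 * (\<delta> t * t powr (2 * q) * (norm (gradient g (x t)))\<^sup>2)) \<and>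
      \<delta> t * t powr (2 * q) * (g (x t) - g xstar) + 1/2 * (norm (v b t))\<^sup>2
        + b * (\<alpha> - b) / 4 * (norm (x t - xstar))\<^sup>2 \<le> E b t + C * tail t"
    using decay[OF b] by blast
  have pos: "0 \<le> b / 2 * (\<delta> t * t powr q * (g (x t) - g xstar))"
    "0 \<le> (\<alpha> - b) / 2 * (t powr q * (norm (tderiv t0 x t))\<^sup>2)"
    "0 \<le> \<beta> / 2 * (\<delta> t * t powr (2 * q) * (norm (gradient g (x t)))\<^sup>2)"
    "0 \<le> \<delta> t * t powr (2 * q) * (g (x t) - g xstar)"
    "0 \<le> 1/2 * (norm (v b t))\<^sup>2" "0 \<le> b * (\<alpha> - b) / 4 * (norm (x t - xstar))\<^sup>2" if "t \<ge> T" for t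
    using b \<open>\<beta> > 0\<close> *[OF that] gt[of "x t"] by (auto intro!: mult_nonneg_nonneg)
  define M where "M = E b T + C * tail T"
  have M: "E b t + C * tail t \<le> M" if "t \<ge> T" for t
    unfolding M_def
  proof (rule antimono_if_derivative_nonpos[OF _ _ order_refl that])
    show "\<Phi>' t \<le> 0" if "t \<ge> T" for t
      using pos[OF that] *[OF that] by linarith
  qed (use * in blast)
  have M_g: "\<delta> t * t powr (2 * q) * (g (x t) - g xstar) \<le> M"
    and M_v: "(norm (v b t))\<^sup>2 \<le> 2 * M"
    and M_x: "b * (\<alpha> - b) / 4 * (norm (x t - xstar))\<^sup>2 \<le> M" if "t \<ge> T" for t
    using pos[OF that] *[OF that] M[OF that] by linarith+
  \<comment> \<open>\<open>r\<close> is the coercivity bound \<open>M_x\<close> solved for the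
    distance to \<open>xstar\<close>.\<close>
  define r where "r = sqrt (M / (b * (\<alpha> - b) / 4))"
  have x_near: "norm (x t - xstar) \<le> r" if "t \<ge> T" for t
    unfolding r_def using M_x[OF that] b
    by (intro real_le_rsqrt) (simp add: field_simps)
  have bounded: "bounded (x ` {t0..})"
  proof -
    have "bounded (x ` {t0..T})"
      by (intro compact_imp_bounded compact_continuous_image continuous_on_subset[OF cont_x]) auto
    moreover have "bounded (x ` {T..})"
    proof (rule bounded_subset[OF bounded_cball])
      show "x ` {T..} \<subseteq> cball xstar r"
        using x_near by (auto simp: dist_norm norm_minus_commute)
    qed
    moreover have "x ` {t0..} = x ` {t0..T} \<union> x ` {T..}"
      using T by (auto simp flip: image_Un intro!: arg_cong[where f = "image x"])
    ultimately show ?thesis by simp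
  qed
  have O_g: "(\<lambda>t. g (x t) - g xstar) \<in> O[at_top](\<lambda>t. 1 / (\<delta> t * t powr (2 * q)))"
  proof (rule bigoI[of _ M])
    show "\<forall>\<^sub>F t in at_top. norm (g (x t) - g xstar) \<le> M * norm (1 / (\<delta> t * t powr (2 * q)))"
      using eventually_ge_at_top[of T]
    proof eventually_elim
      case (elim t)
      then have pos: "\<delta> t * t powr (2 * q) > 0" using * T \<open>t0 > 0\<close> by force
      then have "g (x t) - g xstar \<le> M / (\<delta> t * t powr (2 * q))"
        using M_g[OF elim] by (simp only: pos_le_divide_eq mult.commute)
      moreover have "norm (1 / (\<delta> t * t powr (2 * q))) = 1 / (\<delta> t * t powr (2 * q))"
        using pos by (simp only: real_norm_def abs_divide abs_one abs_of_pos)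
      ultimately show ?case using gt[of "x t"] by simp
    qed
  qed
  \<comment> \<open>Subtracting \<open>b *\<^sub>R (x t - xstar)\<close> from \<open>v b t\<close>
    isolates the wanted vector times \<open>t powr q\<close>; \<open>sqrt (2 * M)\<close> bounds the
    first and \<open>b * r\<close> the second.\<close>
  have O_v: "(\<lambda>t. norm (tderiv t0 x t + \<beta> *\<^sub>R gradient g (x t))) \<in> O[at_top](\<lambda>t. 1 / t powr q)"
  proof (rule bigoI[of _ "sqrt (2 * M) + b * r"])
    show "\<forall>\<^sub>F t in at_top. norm (norm (tderiv t0 x t + \<beta> *\<^sub>R gradient g (x t)))
        \<le> (sqrt (2 * M) + b * r) * norm (1 / t powr q)"
      using eventually_ge_at_top[of T]
    proof eventually_elim
      case (elim t)
      then have t: "t powr q > 0" using T \<open>t0 > 0\<close> by simp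
      have "t powr q * norm (tderiv t0 x t + \<beta> *\<^sub>R gradient g (x t)) = norm (v b t - b *\<^sub>R (x t - xstar))"
        by (simp add: v_def)
      also have "\<dots> \<le> norm (v b t) + b * norm (x t - xstar)"
        using norm_triangle_ineq4[of "v b t" "b *\<^sub>R (x t - xstar)"] b by simp
      also have "\<dots> \<le> sqrt (2 * M) + b * r"
        using M_v[OF elim] x_near[OF elim] b by (intro add_mono mult_left_mono real_le_rsqrt) auto
      finally show ?case using t by (simp add: field_simps)
    qed
  qed
  have cont_powr: "continuous_on {t0..} (\<lambda>t. t powr r)" for r :: real
    using \<open>t0 > 0\<close> by (intro continuous_intros) auto
  have Phi_nonneg: "0 \<le> E b t + C * tail t" if "t \<ge> T" for t
    using pos[OF that] *[OF that] by linarith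
  \<comment> \<open>The dissipation is a sum of three nonnegative terms; each of the next three
    integrals keeps one and drops the other two.\<close>
  have "set_integrable lborel {t0..} (\<lambda>t. \<delta> t * t powr q * (g (x t) - g xstar))"
  proof (rule set_integrable_if_dissipated[OF _ T])
    show "continuous_on {t0..} (\<lambda>t. \<delta> t * t powr q * (g (x t) - g xstar))"
      by (intro continuous_intros \<delta>_cont cont_powr cont_g)
    show "b / 2 > 0" using b by simp
    show "\<Phi>' t \<le> - (b / 2 * (\<delta> t * t powr q * (g (x t) - g xstar)))" if "t \<ge> T" for t
      using pos[OF that] *[OF that] by linarith
    show "0 \<le> \<delta> t * t powr q * (g (x t) - g xstar)" if "t \<ge> T" for t
      using *[OF that] gt[of "x t"] by simp
  qed (use * Phi_nonneg in blast)+
  moreover have "set_integrable lborel {t0..} (\<lambda>t. t powr q * (norm (tderiv t0 x t))\<^sup>2)"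
  proof (rule set_integrable_if_dissipated[OF _ T])
    show "continuous_on {t0..} (\<lambda>t. t powr q * (norm (tderiv t0 x t))\<^sup>2)"
      by (intro continuous_intros cont_V cont_powr)
    show "(\<alpha> - b) / 2 > 0" using b by simp
    show "\<Phi>' t \<le> - ((\<alpha> - b) / 2 * (t powr q * (norm (tderiv t0 x t))\<^sup>2))" if "t \<ge> T" for t
      using pos[OF that] *[OF that] by linarith
    show "0 \<le> t powr q * (norm (tderiv t0 x t))\<^sup>2" for t by simp
  qed (use * Phi_nonneg in blast)+
  moreover have "set_integrable lborel {t0..} (\<lambda>t. \<delta> t * t powr (2 * q) * (norm (gradient g (x t)))\<^sup>2)"
  proof (rule set_integrable_if_dissipated[OF _ T])
    show "continuous_on {t0..} (\<lambda>t. \<delta> t * t powr (2 * q) * (norm (gradient g (x t)))\<^sup>2)"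
      by (intro continuous_intros \<delta>_cont cont_powr cont_D)
    show "\<beta> / 2 > 0" using \<open>\<beta> > 0\<close> by simp
    show "\<Phi>' t \<le> - (\<beta> / 2 * (\<delta> t * t powr (2 * q) * (norm (gradient g (x t)))\<^sup>2))" if "t \<ge> T" for t
      using pos[OF that] *[OF that] by linarith
    show "0 \<le> \<delta> t * t powr (2 * q) * (norm (gradient g (x t)))\<^sup>2" if "t \<ge> T" for t
      using *[OF that] by simp
  qed (use * Phi_nonneg in blast)+
  \<comment> \<open>Boundedness of \<open>x\<close> reduces the claim to integrability of
    \<open>t powr (q - p)\<close>, with a multiple of \<open>tail\<close> as the dissipated
    function. The cases \<open>y = 0\<close> and \<open>y = xstar\<close> are the two claimed
    integrals.\<close>
  moreover have weighted: "set_integrable lborel {t0..} (\<lambda>t. t powr (q - p) * (norm (x t - y))\<^sup>2)" for y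
  proof -
    obtain B where B: "\<And>t. t \<ge> t0 \<Longrightarrow> norm (x t) \<le> B"
      using bounded by (auto simp: bounded_iff)
    have le: "(norm (x t - y))\<^sup>2 \<le> (B + norm y)\<^sup>2" if "t \<ge> T" for t
      using norm_triangle_ineq4[of "x t" y] B[of t] T that by (intro power_mono) auto
    show ?thesis
    proof (rule set_integrable_if_dissipated[OF _ T zero_less_one])
      show "continuous_on {t0..} (\<lambda>t. t powr (q - p) * (norm (x t - y))\<^sup>2)"
        by (intro continuous_intros cont_x cont_powr)
      show "0 \<le> t powr (q - p) * (norm (x t - y))\<^sup>2" for t by simp
      show "((\<lambda>t. (B + norm y)\<^sup>2 * tail t) has_real_derivative (B + norm y)\<^sup>2 * - (t powr (q - p))) (at t)"
        if "t \<ge> T" for t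
        using d_tail[of t] T that by (intro DERIV_cmult) simp
      show "(B + norm y)\<^sup>2 * - (t powr (q - p)) \<le> - (1 * (t powr (q - p) * (norm (x t - y))\<^sup>2))"
        if "t \<ge> T" for t
        using mult_left_mono[OF le[OF that], of "t powr (q - p)"] by (simp add: mult.commute)
      show "0 \<le> (B + norm y)\<^sup>2 * tail t" for t using tail_nonneg by simp
    qed
  qed
  moreover have "set_integrable lborel {t0..} (\<lambda>t. t powr (q - p) * (norm (x t))\<^sup>2)"
    using weighted[of 0] by simp
  ultimately show ?thesis
    using bounded O_g O_v limit unfolding E_def by blast
qed

end
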